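(* Every cubical transition system satisfying CSA1 is fibrant in the left determined model structure of $\mathbf{CTS}$.
   Context: Fix a nonempty set $\Sigma$ (of labels). A weak higher dimensional transition system (weak HDTS) is a triple $(S,\mu:L\to\Sigma,T=\bigcup_{n\ge 1}T_n)$ where $S$ is a set (states), $L$ a set (actions), $\mu$ a set map (labelling map), $T_n\subset S\times L^n\times S$ (the $n$-transitions) such that: (Multiset axiom) if $(\alpha,u_1,\dots,u_n,\beta)\in T$, $n\ge 2$, then $(\alpha,u_{\sigma(1)},\dots,u_{\sigma(n)},\beta)\in T$ for every permutation $\sigma$; (Coherence axiom) for $n\ge 3$, $p,q\ge 1$, $p+q<n$, if $(\alpha,u_1,\dots,u_n,\beta)$, $(\alpha,u_1,\dots,u_p,\nu_1)$, $(\nu_1,u_{p+1},\dots,u_n,\beta)$, $(\alpha,u_1,\dots,u_{p+q},\nu_2)$, $(\nu_2,u_{p+q+1},\dots,u_n,\beta)$ are all transitions, then $(\nu_1,u_{p+1},\dots,u_{p+q},\nu_2)$ is a transition. A map $f$ of weak HDTS consists of a map $f_0$ on states and a label-preserving map $\widetilde f$ on actions carrying transitions to transitions. The category is $\mathbf{WHDTS}$. For $n\ge 0$ and $x_1,\dots,x_n\in\Sigma$, the $n$-cube $C_n[x_1,\dots,x_n]$ has states $\{0,1\}^n$, actions $\{(x_1,1),\dots,(x_n,n)\}$ with $\mu(x_i,i)=x_i$, and transitions all tuples $((\epsilon_1,\dots,\epsilon_n),(x_{i_1},i_1),\dots,(x_{i_d},i_d),(\epsilon'_1,\dots,\epsilon'_n))$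 with $d\geq 1$, $i_1,\dots,i_d$ pairwise distinct, $\epsilon_i\le\epsilon'_i$ for all $i$, and $\epsilon_i\ne\epsilon'_i$ iff $i\in\{i_1,\dots,i_d\}$. A subcube of $X$ is the image (smallest subobject through which the map factors) of a map $C_n[x_1,\dots,x_n]\to X$. A weak HDTS is a cubical transition system if it equals the union (least upper bound in its poset of subobjects) of its subcubes. $\mathbf{CTS}\subset\mathbf{WHDTS}$ is the full (coreflective, locally presentable) subcategory of cubical transition systems. A cofibration of cubical transition systems is a map $f$ of $\mathbf{CTS}$ such that $\widetilde f$ is injective on actions. For a class $\mathcal A$ of maps of a category, an $\mathcal A$-localizer is a class $\mathcal W$ of maps satisfying two-out-of-three, containing all maps with the right lifting property with respect to $\mathcal A$, and such that $\mathcal A\cap\mathcal W$ is closed under pushout and transfinite composition. The left determined model structure of $\mathbf{CTS}$ is the model structure (which exists and is unique) whose cofibrations are the cofibrations of cubical transition systems and whose weak equivalences form the smallest localizer of $\mathbf{CTS}$ with respect to this class of cofibrations. A cubical transition system satisfies CSA1 (First Cattani-Sassone axiom) if whenever $(\alpha,u,\beta)$ and $(\alpha,u',\beta)$ are transitions with $\mu(u)=\mu(u')$, one has $u=u'$. *)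

theory Defs
  imports "HOL-Combinatorics.Permutations" "HOL-Library.FuncSet" "HOL-Library.Equipollence"
begin

section \<open>Categories, lifting properties, localizers and model structures\<close>

record ('o, 'm) precat =
  Ob :: "'o set"
  Ar :: "'m set"
  src :: "'m \<Rightarrow> 'o"
  tgt :: "'m \<Rightarrow> 'o"
  ident :: "'o \<Rightarrow> 'm"
  cmp :: "'m \<Rightarrow> 'm \<Rightarrow> 'm"  \<comment> \<open>\<open>cmp C g f\<close> is \<open>g\<close> after \<open>f\<close>\<close>

definition hom :: "('o, 'm) precat \<Rightarrow> 'o \<Rightarrow> 'o \<Rightarrow> 'm set" where
  "hom C A B = {f \<in> Ar C. src C f = A \<and> tgt C f = B}"

definition category :: "('o, 'm) precat \<Rightarrow> bool" where
  "category C \<longleftrightarrow>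
     (\<forall>f\<in>Ar C. src C f \<in> Ob C \<and> tgt C f \<in> Ob C) \<and>
     (\<forall>A\<in>Ob C. ident C A \<in> hom C A A) \<and>
     (\<forall>A B D f g. f \<in> hom C A B \<longrightarrow> g \<in> hom C B D \<longrightarrow> cmp C g f \<in> hom C A D) \<and>
     (\<forall>A B f. f \<in> hom C A B \<longrightarrow> cmp C f (ident C A) = f \<and> cmp C (ident C B) f = f) \<and>
     (\<forall>A B D E f g h. f \<in> hom C A B \<longrightarrow> g \<in> hom C B D \<longrightarrow> h \<in> hom C D E \<longrightarrow>
        cmp C h (cmp C g f) = cmp C (cmp C h g) f)"

definition mono_arrow :: "('o, 'm) precat \<Rightarrow> 'm \<Rightarrow> bool" where
  "mono_arrow C f \<longleftrightarrow> f \<in> Ar C \<and>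
     (\<forall>A g h. g \<in> hom C A (src C f) \<longrightarrow> h \<in> hom C A (src C f) \<longrightarrow>
        cmp C f g = cmp C f h \<longrightarrow> g = h)"

definition terminal_object :: "('o, 'm) precat \<Rightarrow> 'o \<Rightarrow> bool" where
  "terminal_object C T \<longleftrightarrow> T \<in> Ob C \<and> (\<forall>A\<in>Ob C. \<exists>!f. f \<in> hom C A T)"

definition lifts :: "('o, 'm) precat \<Rightarrow> 'm \<Rightarrow> 'm \<Rightarrow> bool" where
  "lifts C i p \<longleftrightarrow>
     (\<forall>u v. u \<in> hom C (src C i) (src C p) \<longrightarrow> v \<in> hom C (tgt C i) (tgt C p) \<longrightarrow>
        cmp C p u = cmp C v i \<longrightarrow>
        (\<exists>h \<in> hom C (tgt C i) (src C p). cmp C h i = u \<and> cmp C p h = v))"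

definition rlp :: "('o, 'm) precat \<Rightarrow> 'm set \<Rightarrow> 'm set" where
  "rlp C K = {p \<in> Ar C. \<forall>i\<in>K. lifts C i p}"

definition llp :: "('o, 'm) precat \<Rightarrow> 'm set \<Rightarrow> 'm set" where
  "llp C K = {i \<in> Ar C. \<forall>p\<in>K. lifts C i p}"

definition two_out_of_three :: "('o, 'm) precat \<Rightarrow> 'm set \<Rightarrow> bool" where
  "two_out_of_three C W \<longleftrightarrow>
     (\<forall>f g. f \<in> Ar C \<longrightarrow> g \<in> Ar C \<longrightarrow> tgt C f = src C g \<longrightarrow>
        (f \<in> W \<and> g \<in> W \<longrightarrow> cmp C g f \<in> W) \<and>
        (f \<in> W \<and> cmp C g f \<in> W \<longrightarrow> g \<in> W) \<and>
        (g \<in> W \<and> cmp C g f \<in> W \<longrightarrow> f \<in> W))"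

text \<open>In \<open>pushout C f g f' g'\<close> the arrow \<open>f'\<close> is the pushout of \<open>f\<close> along \<open>g\<close>.\<close>

definition pushout :: "('o, 'm) precat \<Rightarrow> 'm \<Rightarrow> 'm \<Rightarrow> 'm \<Rightarrow> 'm \<Rightarrow> bool" where
  "pushout C f g f' g' \<longleftrightarrow>
     f \<in> Ar C \<and> g \<in> Ar C \<and> f' \<in> Ar C \<and> g' \<in> Ar C \<and>
     src C f = src C g \<and> tgt C f = src C g' \<and> tgt C g = src C f' \<and> tgt C f' = tgt C g' \<and>
     cmp C g' f = cmp C f' g \<and>
     (\<forall>Z a b. a \<in> hom C (tgt C f) Z \<longrightarrow> b \<in> hom C (tgt C g) Z \<longrightarrow> cmp C a f = cmp C b g \<longrightarrow>
        (\<exists>!h. h \<in> hom C (tgt C f') Z \<and> cmp C h g' = a \<and> cmp C h f' = b))"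

definition closed_under_pushout :: "('o, 'm) precat \<Rightarrow> 'm set \<Rightarrow> bool" where
  "closed_under_pushout C K \<longleftrightarrow> (\<forall>f g f' g'. f \<in> K \<longrightarrow> pushout C f g f' g' \<longrightarrow> f' \<in> K)"

text \<open>Ordinals are represented by well-orders. A diagram on the well-order \<open>r\<close> has objects \<open>D i\<close>
  for \<open>i\<close> in the field of \<open>r\<close> and arrows \<open>d i j\<close> for \<open>(i, j) \<in> r\<close>.\<close>

definition diagram ::
    "('o, 'm) precat \<Rightarrow> 'i rel \<Rightarrow> ('i \<Rightarrow> 'o) \<Rightarrow> ('i \<Rightarrow> 'i \<Rightarrow> 'm) \<Rightarrow> bool" where
  "diagram C r D d \<longleftrightarrow>
     (\<forall>i\<in>Field r. D i \<in> Ob C \<and> d i i = ident C (D i)) \<and>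
     (\<forall>i j. (i, j) \<in> r \<longrightarrow> d i j \<in> hom C (D i) (D j)) \<and>
     (\<forall>i j k. (i, j) \<in> r \<longrightarrow> (j, k) \<in> r \<longrightarrow> cmp C (d j k) (d i j) = d i k)"

definition cocone ::
    "('o, 'm) precat \<Rightarrow> 'i rel \<Rightarrow> 'i set \<Rightarrow> ('i \<Rightarrow> 'o) \<Rightarrow> ('i \<Rightarrow> 'i \<Rightarrow> 'm) \<Rightarrow>
     'o \<Rightarrow> ('i \<Rightarrow> 'm) \<Rightarrow> bool" where
  "cocone C r I D d Y c \<longleftrightarrow>
     Y \<in> Ob C \<and> (\<forall>i\<in>I. c i \<in> hom C (D i) Y) \<and>
     (\<forall>i\<in>I. \<forall>j\<in>I. (i, j) \<in> r \<longrightarrow> cmp C (c j) (d i j) = c i)"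

definition colimit_cocone ::
    "('o, 'm) precat \<Rightarrow> 'i rel \<Rightarrow> 'i set \<Rightarrow> ('i \<Rightarrow> 'o) \<Rightarrow> ('i \<Rightarrow> 'i \<Rightarrow> 'm) \<Rightarrow>
     'o \<Rightarrow> ('i \<Rightarrow> 'm) \<Rightarrow> bool" where
  "colimit_cocone C r I D d Y c \<longleftrightarrow>
     cocone C r I D d Y c \<and>
     (\<forall>Z b. cocone C r I D d Z b \<longrightarrow>
        (\<exists>!h. h \<in> hom C Y Z \<and> (\<forall>i\<in>I. cmp C h (c i) = b i)))"

definition covers :: "'i rel \<Rightarrow> 'i \<Rightarrow> 'i \<Rightarrow> bool" where
  "covers r i j \<longleftrightarrow> i \<in> underS r j \<and> (\<forall>k \<in> underS r j. (k, i) \<in> r)"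

definition limit_element :: "'i rel \<Rightarrow> 'i \<Rightarrow> bool" where
  "limit_element r j \<longleftrightarrow> j \<in> Field r \<and> underS r j \<noteq> {} \<and> (\<nexists>i. covers r i j)"

text \<open>The arrow \<open>f\<close> is the map from \<open>D 0\<close> to the colimit of a colimit-preserving diagram
  on \<open>r\<close> all of whose successor steps belong to \<open>K\<close>.\<close>

definition transfinite_composition ::
    "('o, 'm) precat \<Rightarrow> 'i rel \<Rightarrow> 'm set \<Rightarrow> 'm \<Rightarrow> bool" where
  "transfinite_composition C r K f \<longleftrightarrow>
     (\<exists>D d Y c i0.
        diagram C r D d \<and>
        (\<forall>i j. covers r i j \<longrightarrow> d i j \<in> K) \<and>
        (\<forall>j. limit_element r j \<longrightarrow> colimit_cocone C r (underS r j) D d (D j) (\<lambda>i. d i j)) \<and>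
        colimit_cocone C r (Field r) D d Y c \<and>
        i0 \<in> Field r \<and> (\<forall>i\<in>Field r. (i0, i) \<in> r) \<and> f = c i0)"

text \<open>The set \<open>R\<close> collects the well-orders (ordinals) allowed as shapes of transfinite
  compositions.\<close>

definition closed_under_transfinite_composition ::
    "('o, 'm) precat \<Rightarrow> 'i rel set \<Rightarrow> 'm set \<Rightarrow> bool" where
  "closed_under_transfinite_composition C R K \<longleftrightarrow>
     (\<forall>r\<in>R. \<forall>f. transfinite_composition C r K f \<longrightarrow> f \<in> K)"

definition localizer :: "('o, 'm) precat \<Rightarrow> 'i rel set \<Rightarrow> 'm set \<Rightarrow> 'm set \<Rightarrow> bool" where
  "localizer C R A W \<longleftrightarrow>
     W \<subseteq> Ar C \<and>
     two_out_of_three C W \<and>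
     rlp C A \<subseteq> W \<and>
     closed_under_pushout C (A \<inter> W) \<and>
     closed_under_transfinite_composition C R (A \<inter> W)"

definition smallest_localizer :: "('o, 'm) precat \<Rightarrow> 'i rel set \<Rightarrow> 'm set \<Rightarrow> 'm set" where
  "smallest_localizer C R A = {f \<in> Ar C. \<forall>W. localizer C R A W \<longrightarrow> f \<in> W}"

lemma transfinite_composition_mono:
  assumes f: "transfinite_composition C r K f" and "K \<subseteq> K'"
  shows "transfinite_composition C r K' f"
proof -
  obtain D d Y c i0 where *: "diagram C r D d" "\<forall>i j. covers r i j \<longrightarrow> d i j \<in> K"
      "\<forall>j. limit_element r j \<longrightarrow> colimit_cocone C r (underS r j) D d (D j) (\<lambda>i. d i j)"
      "colimit_cocone C r (Field r) D d Y c" "i0 \<in> Field r" "\<forall>i\<in>Field r. (i0, i) \<in> r" "f = c i0"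
    using f unfolding transfinite_composition_def by (elim exE conjE) rule
  have "\<forall>i j. covers r i j \<longrightarrow> d i j \<in> K'" using *(2) \<open>K \<subseteq> K'\<close> by blast
  with * show ?thesis
    unfolding transfinite_composition_def
    by (intro exI[of _ D] exI[of _ d] exI[of _ Y] exI[of _ c] exI[of _ i0] conjI)
qed

lemma smallest_localizer_least:
  "localizer C R A W \<Longrightarrow> smallest_localizer C R A \<subseteq> W"
  by (auto simp: smallest_localizer_def)

lemma smallest_localizer_is_localizer:
  assumes C: "category C" and ex: "localizer C R A W0"
  shows "localizer C R A (smallest_localizer C R A)"
proof -
  let ?S = "smallest_localizer C R A"
  have S: "f \<in> ?S \<longleftrightarrow> (\<forall>W. localizer C R A W \<longrightarrow> f \<in> W)" for f
    using ex by (auto simp: smallest_localizer_def localizer_def)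
  have "two_out_of_three C ?S"
    unfolding two_out_of_three_def S
  proof (intro allI impI conjI; elim conjE)
    fix f g W
    assume fg: "f \<in> Ar C" "g \<in> Ar C" "tgt C f = src C g" and W: "localizer C R A W"
    note * = W[unfolded localizer_def two_out_of_three_def, THEN conjunct2, THEN conjunct1,
        rule_format, OF fg]
    show "cmp C g f \<in> W" if "\<forall>W. localizer C R A W \<longrightarrow> f \<in> W" "\<forall>W. localizer C R A W \<longrightarrow> g \<in> W"
      using * that W by blast
    show "g \<in> W" if "\<forall>W. localizer C R A W \<longrightarrow> f \<in> W" "\<forall>W. localizer C R A W \<longrightarrow> cmp C g f \<in> W"
      using * that W by blast
    show "f \<in> W" if "\<forall>W. localizer C R A W \<longrightarrow> g \<in> W" "\<forall>W. localizer C R A W \<longrightarrow> cmp C g f \<in> W"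
      using * that W by blast
  qed
  moreover have "closed_under_pushout C (A \<inter> ?S)"
    unfolding closed_under_pushout_def
  proof (intro allI impI)
    fix f g f' g' assume f: "f \<in> A \<inter> ?S" and po: "pushout C f g f' g'"
    have "f' \<in> A \<inter> W" if W: "localizer C R A W" for W
    proof -
      have "f \<in> A \<inter> W" using f S W by auto
      then show ?thesis
        using W po unfolding localizer_def closed_under_pushout_def by blast
    qed
    then show "f' \<in> A \<inter> ?S" using S ex by auto
  qed
  moreover have "closed_under_transfinite_composition C R (A \<inter> ?S)"
    unfolding closed_under_transfinite_composition_def
  proof (intro ballI allI impI)
    fix r f assume r: "r \<in> R" and f: "transfinite_composition C r (A \<inter> ?S) f"
    have "f \<in> A \<inter> W" if W: "localizer C R A W" for W
    proof -
      have "A \<inter> ?S \<subseteq> A \<inter> W" using S W by auto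
      from transfinite_composition_mono[OF f this] show ?thesis
        using W r by (auto simp: localizer_def closed_under_transfinite_composition_def)
    qed
    then show "f \<in> A \<inter> ?S" using S ex by auto
  qed
  ultimately show ?thesis
    unfolding localizer_def[of C R A ?S]
  proof (intro conjI)
    show "?S \<subseteq> Ar C" by (auto simp: smallest_localizer_def)
    show "rlp C A \<subseteq> ?S" using S unfolding localizer_def by blast
  qed
qed

record 'm model_data =
  cofs :: "'m set"
  weqs :: "'m set"
  fibs :: "'m set"

definition weak_factorization_system :: "('o, 'm) precat \<Rightarrow> 'm set \<Rightarrow> 'm set \<Rightarrow> bool" where
  "weak_factorization_system C L R \<longleftrightarrow>
     L = llp C R \<and> R = rlp C L \<and>
     (\<forall>f\<in>Ar C. \<exists>i\<in>L. \<exists>p\<in>R. tgt C i = src C p \<and> f = cmp C p i)"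

definition model_structure :: "('o, 'm) precat \<Rightarrow> 'm model_data \<Rightarrow> bool" where
  "model_structure C M \<longleftrightarrow>
     weqs M \<subseteq> Ar C \<and> two_out_of_three C (weqs M) \<and>
     weak_factorization_system C (cofs M) (fibs M \<inter> weqs M) \<and>
     weak_factorization_system C (cofs M \<inter> weqs M) (fibs M)"

definition left_determined :: "('o, 'm) precat \<Rightarrow> 'i rel set \<Rightarrow> 'm set \<Rightarrow> 'm model_data" where
  "left_determined C R A =
     \<lparr>cofs = A, weqs = smallest_localizer C R A, fibs = rlp C (A \<inter> smallest_localizer C R A)\<rparr>"

text \<open>The fibrations are not a choice: any model structure with the prescribed cofibrations and
  weak equivalences is the one above.\<close>

lemma left_determined_unique:
  assumes "model_structure C M" "cofs M = A" "weqs M = smallest_localizer C R A"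
  shows "M = left_determined C R A"
proof (rule model_data.equality)
  have "fibs M = rlp C (cofs M \<inter> weqs M)"
    using assms(1) unfolding model_structure_def weak_factorization_system_def by blast
  then show "fibs M = fibs (left_determined C R A)"
    by (simp only: assms(2,3) left_determined_def model_data.simps)
qed (simp_all add: assms(2,3) left_determined_def)

definition fibrant :: "('o, 'm) precat \<Rightarrow> 'm model_data \<Rightarrow> 'o \<Rightarrow> bool" where
  "fibrant C M X \<longleftrightarrow> X \<in> Ob C \<and> (\<exists>T. \<exists>f \<in> hom C X T. terminal_object C T \<and> f \<in> fibs M)"


section \<open>Weak higher dimensional transition systems\<close>

text \<open>The set of labels is the type \<open>'l\<close>. An \<open>n\<close>-transition is a triple \<open>(\<alpha>, us, \<beta>)\<close> with
  \<open>us\<close> a list of \<open>n\<close> actions.\<close>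

record ('s, 'a, 'l) hdts =
  states :: "'s set"
  actions :: "'a set"
  label :: "'a \<Rightarrow> 'l"
  transitions :: "('s \<times> 'a list \<times> 's) set"

definition whdts :: "('s, 'a, 'l) hdts \<Rightarrow> bool" where
  "whdts X \<longleftrightarrow>
     label X \<in> extensional (actions X) \<and>
     (\<forall>\<alpha> us \<beta>. (\<alpha>, us, \<beta>) \<in> transitions X \<longrightarrow>
        \<alpha> \<in> states X \<and> \<beta> \<in> states X \<and> set us \<subseteq> actions X \<and> length us \<ge> 1) \<and>
     \<comment> \<open>multiset axiom\<close>
     (\<forall>\<alpha> us \<beta> \<sigma>. (\<alpha>, us, \<beta>) \<in> transitions X \<longrightarrow> length us \<ge> 2 \<longrightarrow> \<sigma> permutes {..<length us} \<longrightarrow>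
        (\<alpha>, permute_list \<sigma> us, \<beta>) \<in> transitions X) \<and>
     \<comment> \<open>coherence axiom; \<open>us\<close>, \<open>vs\<close>, \<open>ws\<close> have lengths \<open>p\<close>, \<open>q\<close>, \<open>n - p - q\<close>\<close>
     (\<forall>\<alpha> \<beta> \<nu>1 \<nu>2 us vs ws. us \<noteq> [] \<longrightarrow> vs \<noteq> [] \<longrightarrow> ws \<noteq> [] \<longrightarrow>
        (\<alpha>, us @ vs @ ws, \<beta>) \<in> transitions X \<longrightarrow>
        (\<alpha>, us, \<nu>1) \<in> transitions X \<longrightarrow> (\<nu>1, vs @ ws, \<beta>) \<in> transitions X \<longrightarrow>
        (\<alpha>, us @ vs, \<nu>2) \<in> transitions X \<longrightarrow> (\<nu>2, ws, \<beta>) \<in> transitions X \<longrightarrow>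
        (\<nu>1, vs, \<nu>2) \<in> transitions X)"

definition hdts_map ::
    "('s, 'a, 'l) hdts \<Rightarrow> ('t, 'b, 'l) hdts \<Rightarrow> ('s \<Rightarrow> 't) \<Rightarrow> ('a \<Rightarrow> 'b) \<Rightarrow> bool" where
  "hdts_map X Y f0 f1 \<longleftrightarrow>
     f0 \<in> states X \<rightarrow>\<^sub>E states Y \<and>
     f1 \<in> actions X \<rightarrow>\<^sub>E actions Y \<and>
     (\<forall>u\<in>actions X. label Y (f1 u) = label X u) \<and>
     (\<forall>\<alpha> us \<beta>. (\<alpha>, us, \<beta>) \<in> transitions X \<longrightarrow> (f0 \<alpha>, map f1 us, f0 \<beta>) \<in> transitions Y)"

text \<open>Indices run from \<open>0\<close> to \<open>n - 1\<close> instead of from \<open>1\<close> to \<open>n\<close>.\<close>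

definition cube :: "'l list \<Rightarrow> (bool list, 'l \<times> nat, 'l) hdts" where
  "cube xs =
     \<lparr>states = {\<epsilon>. length \<epsilon> = length xs},
      actions = {(xs ! i, i) | i. i < length xs},
      label = restrict fst {(xs ! i, i) | i. i < length xs},
      transitions = {(\<epsilon>, map (\<lambda>i. (xs ! i, i)) is, \<epsilon>') | \<epsilon> is \<epsilon>'.
        length \<epsilon> = length xs \<and> length \<epsilon>' = length xs \<and>
        is \<noteq> [] \<and> distinct is \<and> set is \<subseteq> {..<length xs} \<and>
        (\<forall>i<length xs. \<epsilon> ! i \<le> \<epsilon>' ! i) \<and>
        (\<forall>i<length xs. \<epsilon> ! i \<noteq> \<epsilon>' ! i \<longleftrightarrow> i \<in> set is)}\<rparr>"

lemma whdts_cube: "whdts (cube xs)"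
proof -
  let ?f = "\<lambda>i. (xs ! i, i)" and ?n = "length xs"
  define tr where "tr \<epsilon> is \<epsilon>' \<longleftrightarrow> length \<epsilon> = ?n \<and> length \<epsilon>' = ?n \<and>
    is \<noteq> [] \<and> distinct is \<and> set is \<subseteq> {..<?n} \<and> (\<forall>i<?n. \<epsilon> ! i \<le> \<epsilon>' ! i) \<and>
    (\<forall>i<?n. \<epsilon> ! i \<noteq> \<epsilon>' ! i \<longleftrightarrow> i \<in> set is)"
    for \<epsilon> \<epsilon>' :: "bool list" and "is"
  have T: "(\<epsilon>, us, \<epsilon>') \<in> transitions (cube xs) \<longleftrightarrow> (\<exists>is. us = map ?f is \<and> tr \<epsilon> is \<epsilon>')" for \<epsilon> us \<epsilon>'
    by (auto simp: cube_def tr_def)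
  have inj: "inj ?f" by (auto simp: inj_def)
  have T': "(\<epsilon>, map ?f is, \<epsilon>') \<in> transitions (cube xs) \<longleftrightarrow> tr \<epsilon> is \<epsilon>'" for \<epsilon> "is" \<epsilon>'
    unfolding T using inj by (auto dest: map_injective)
  show ?thesis
    unfolding whdts_def
  proof (intro conjI allI impI)
    show "label (cube xs) \<in> extensional (actions (cube xs))" by (simp add: cube_def)
  next
    fix \<alpha> us \<beta> assume "(\<alpha>, us, \<beta>) \<in> transitions (cube xs)"
    then obtain "is" where "us = map ?f is" "tr \<alpha> is \<beta>" unfolding T by blast
    then show "\<alpha> \<in> states (cube xs)" "\<beta> \<in> states (cube xs)" "set us \<subseteq> actions (cube xs)"
      "length us \<ge> 1"
      by (auto simp: tr_def cube_def Suc_le_eq)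
  next
    fix \<alpha> us \<beta> \<sigma>
    assume t: "(\<alpha>, us, \<beta>) \<in> transitions (cube xs)" and s: "\<sigma> permutes {..<length us}"
    from t obtain "is" where i: "us = map ?f is" "tr \<alpha> is \<beta>" unfolding T by blast
    have s': "\<sigma> permutes {..<length is}" using s i by simp
    have "tr \<alpha> (permute_list \<sigma> is) \<beta>"
      using i(2) s' unfolding tr_def
      by (metis distinct_permute_list set_permute_list length_permute_list length_0_conv)
    then show "(\<alpha>, permute_list \<sigma> us, \<beta>) \<in> transitions (cube xs)"
      unfolding i(1) permute_list_map[OF s'] T' .
  next
    fix \<alpha> \<beta> \<nu>1 \<nu>2 us vs ws
    assume ne: "vs \<noteq> []"
      and t: "(\<alpha>, us @ vs @ ws, \<beta>) \<in> transitions (cube xs)"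
        "(\<alpha>, us, \<nu>1) \<in> transitions (cube xs)" "(\<nu>1, vs @ ws, \<beta>) \<in> transitions (cube xs)"
        "(\<alpha>, us @ vs, \<nu>2) \<in> transitions (cube xs)" "(\<nu>2, ws, \<beta>) \<in> transitions (cube xs)"
    from t(1) obtain "is" where "us @ vs @ ws = map ?f is" unfolding T by blast
    then obtain a b c where abc: "us = map ?f a" "vs = map ?f b" "ws = map ?f c"
      by (auto simp: append_eq_map_conv)
    have u: "tr \<alpha> (a @ b @ c) \<beta>" "tr \<alpha> a \<nu>1" "tr \<nu>1 (b @ c) \<beta>" "tr \<alpha> (a @ b) \<nu>2"
      using t unfolding abc map_append[symmetric] T' by blast+
    have "b \<noteq> []" using ne abc by simp
    moreover have "\<nu>1 ! i \<le> \<nu>2 ! i \<and> (\<nu>1 ! i \<noteq> \<nu>2 ! i \<longleftrightarrow> i \<in> set b)" if "i < ?n" for i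
    proof -
      have "i \<in> set a \<Longrightarrow> i \<notin> set b" using u(4) by (auto simp: tr_def)
      moreover have "\<alpha> ! i \<noteq> \<nu>1 ! i \<longleftrightarrow> i \<in> set a" "\<alpha> ! i \<noteq> \<nu>2 ! i \<longleftrightarrow> i \<in> set a \<or> i \<in> set b"
        "\<alpha> ! i \<longrightarrow> \<nu>1 ! i" "\<alpha> ! i \<longrightarrow> \<nu>2 ! i"
        using u(2,4) that by (auto simp: tr_def)
      ultimately show ?thesis by auto
    qed
    ultimately have "tr \<nu>1 b \<nu>2" using u(2,4) by (auto simp: tr_def)
    then show "(\<nu>1, vs, \<nu>2) \<in> transitions (cube xs)" unfolding abc T' .
  qed
qed

text \<open>Monomorphisms of weak HDTS are the maps injective on states and on actions (lemma
  \<open>mono_arrow_WHDTS_iff\<close> below), so every subobject of \<open>X\<close> has exactly one representative whose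
  inclusion map is the identity on elements. It may have fewer transitions than \<open>X\<close> between its
  own states.\<close>

definition subobject :: "('s, 'a, 'l) hdts \<Rightarrow> ('s, 'a, 'l) hdts \<Rightarrow> bool" where
  "subobject Y X \<longleftrightarrow>
     whdts Y \<and> states Y \<subseteq> states X \<and> actions Y \<subseteq> actions X \<and>
     label Y = restrict (label X) (actions Y) \<and> transitions Y \<subseteq> transitions X"

definition is_image ::
    "('t, 'b, 'l) hdts \<Rightarrow> ('s, 'a, 'l) hdts \<Rightarrow> ('t \<Rightarrow> 's) \<Rightarrow> ('b \<Rightarrow> 'a) \<Rightarrow>
     ('s, 'a, 'l) hdts \<Rightarrow> bool" where
  "is_image C X f0 f1 Y \<longleftrightarrow>
     subobject Y X \<and> hdts_map C Y f0 f1 \<and>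
     (\<forall>Z. subobject Z X \<longrightarrow> hdts_map C Z f0 f1 \<longrightarrow> subobject Y Z)"

definition subcubes :: "('s, 'a, 'l) hdts \<Rightarrow> ('s, 'a, 'l) hdts set" where
  "subcubes X = {Y. \<exists>xs f0 f1. hdts_map (cube xs) X f0 f1 \<and> is_image (cube xs) X f0 f1 Y}"

text \<open>Least upper bound in the poset of subobjects of \<open>X\<close>; in general larger than the
  componentwise union, which may violate the coherence axiom.\<close>

definition is_union ::
    "('s, 'a, 'l) hdts \<Rightarrow> ('s, 'a, 'l) hdts set \<Rightarrow> ('s, 'a, 'l) hdts \<Rightarrow> bool" where
  "is_union X K Y \<longleftrightarrow>
     subobject Y X \<and> (\<forall>A\<in>K. subobject A Y) \<and>
     (\<forall>Z. subobject Z X \<longrightarrow> (\<forall>A\<in>K. subobject A Z) \<longrightarrow> subobject Y Z)"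

definition cubical :: "('s, 'a, 'l) hdts \<Rightarrow> bool" where
  "cubical X \<longleftrightarrow> whdts X \<and> is_union X (subcubes X) X"

definition CSA1 :: "('s, 'a, 'l) hdts \<Rightarrow> bool" where
  "CSA1 X \<longleftrightarrow>
     (\<forall>\<alpha> \<beta> u u'. (\<alpha>, [u], \<beta>) \<in> transitions X \<longrightarrow> (\<alpha>, [u'], \<beta>) \<in> transitions X \<longrightarrow>
        label X u = label X u' \<longrightarrow> u = u')"


section \<open>The categories of weak HDTS and of cubical transition systems\<close>

record ('s, 'a, 'l) hdts_arrow =
  source :: "('s, 'a, 'l) hdts"
  target :: "('s, 'a, 'l) hdts"
  st :: "'s \<Rightarrow> 's"
  ac :: "'a \<Rightarrow> 'a"

definition full_category ::
    "('s, 'a, 'l) hdts set \<Rightarrow> (('s, 'a, 'l) hdts, ('s, 'a, 'l) hdts_arrow) precat" where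
  "full_category K =
     \<lparr>Ob = K,
      Ar = {f. source f \<in> K \<and> target f \<in> K \<and> hdts_map (source f) (target f) (st f) (ac f)},
      src = source,
      tgt = target,
      ident = (\<lambda>X. \<lparr>source = X, target = X,
        st = restrict (\<lambda>x. x) (states X), ac = restrict (\<lambda>x. x) (actions X)\<rparr>),
      cmp = (\<lambda>g f. \<lparr>source = source f, target = target g,
        st = compose (states (source f)) (st g) (st f),
        ac = compose (actions (source f)) (ac g) (ac f)\<rparr>)\<rparr>"

text \<open>The type \<open>'u\<close> plays the role of the universe of sets: states and actions are elements
  of \<open>'u\<close>, and the small sets are the subsets of \<open>'u\<close> of cardinality smaller than that
  of \<open>'u\<close>. When the cardinality of \<open>'u\<close> is inaccessible, these are up to bijection the sets of a
  Grothendieck universe.\<close>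

definition small :: "'u set \<Rightarrow> bool" where
  "small A \<longleftrightarrow> A \<prec> (UNIV :: 'u set)"

definition small_ordinals :: "'u rel set" where
  "small_ordinals = {r. Well_order r \<and> small (Field r)}"

definition WHDTS ::
    "(('u, 'u, 'l) hdts, ('u, 'u, 'l) hdts_arrow) precat" where
  "WHDTS = full_category {X. whdts X \<and> small (states X) \<and> small (actions X)}"

definition CTS ::
    "(('u, 'u, 'l) hdts, ('u, 'u, 'l) hdts_arrow) precat" where
  "CTS = full_category {X. cubical X \<and> small (states X) \<and> small (actions X)}"

definition cofibrations :: "('u, 'u, 'l) hdts_arrow set" where
  "cofibrations = {f \<in> Ar CTS. inj_on (ac f) (actions (source f))}"

definition left_determined_CTS :: "('u, 'u, 'l) hdts_arrow model_data" where
  "left_determined_CTS = left_determined CTS (small_ordinals :: 'u rel set) cofibrations"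

lemma hdts_map_id:
  assumes "whdts X"
  shows "hdts_map X X (restrict (\<lambda>x. x) (states X)) (restrict (\<lambda>x. x) (actions X))"
proof -
  have "map (restrict (\<lambda>x. x) (actions X)) us = us" if "set us \<subseteq> actions X" for us
    using that by (intro map_idI) auto
  with assms show ?thesis by (auto simp: hdts_map_def whdts_def)
qed

lemma hdts_map_compose:
  assumes X: "whdts X" and f: "hdts_map X Y f0 f1" and g: "hdts_map Y Z g0 g1"
  shows "hdts_map X Z (compose (states X) g0 f0) (compose (actions X) g1 f1)"
proof -
  have eq: "map (compose (actions X) g1 f1) us = map g1 (map f1 us)" if "set us \<subseteq> actions X" for us
    using that by (auto simp: compose_def)
  show ?thesis
    unfolding hdts_map_def
  proof (intro conjI allI impI ballI)
    fix \<alpha> us \<beta> assume t: "(\<alpha>, us, \<beta>) \<in> transitions X"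
    then have w: "\<alpha> \<in> states X" "\<beta> \<in> states X" "set us \<subseteq> actions X"
      using X unfolding whdts_def by blast+
    have "(g0 (f0 \<alpha>), map g1 (map f1 us), g0 (f0 \<beta>)) \<in> transitions Z"
      using t f g unfolding hdts_map_def by blast
    then show "(compose (states X) g0 f0 \<alpha>, map (compose (actions X) g1 f1) us,
        compose (states X) g0 f0 \<beta>) \<in> transitions Z"
      using w by (simp only: eq compose_eq)
  next
    fix u assume u: "u \<in> actions X"
    moreover have "f1 u \<in> actions Y" using f u unfolding hdts_map_def by (blast dest: PiE_mem)
    ultimately show "label Z (compose (actions X) g1 f1 u) = label X u"
      using f g by (simp add: hdts_map_def compose_eq)
  next
    have "f0 \<in> states X \<rightarrow> states Y" "g0 \<in> states Y \<rightarrow> states Z"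
      "f1 \<in> actions X \<rightarrow> actions Y" "g1 \<in> actions Y \<rightarrow> actions Z"
      using f g unfolding hdts_map_def PiE_def by blast+
    then show "compose (states X) g0 f0 \<in> states X \<rightarrow>\<^sub>E states Z"
      "compose (actions X) g1 f1 \<in> actions X \<rightarrow>\<^sub>E actions Z"
      by (simp_all add: PiE_def funcset_compose compose_extensional)
  qed
qed

lemma category_full_category:
  assumes K: "\<And>X. X \<in> K \<Longrightarrow> whdts X"
  shows "category (full_category K)"
proof -
  have f: "st f \<in> states (source f) \<rightarrow> states (target f)" "st f \<in> extensional (states (source f))"
      "ac f \<in> actions (source f) \<rightarrow> actions (target f)" "ac f \<in> extensional (actions (source f))"
    if "hdts_map (source f) (target f) (st f) (ac f)" for f :: "('a, 'b, 'c) hdts_arrow"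
    using that unfolding hdts_map_def PiE_def by blast+
  show ?thesis
    unfolding category_def
  proof (intro conjI ballI allI impI)
    fix g assume "g \<in> Ar (full_category K)"
    then show "src (full_category K) g \<in> Ob (full_category K)"
      "tgt (full_category K) g \<in> Ob (full_category K)"
      by (simp_all add: full_category_def)
  next
    fix X assume "X \<in> Ob (full_category K)"
    then show "ident (full_category K) X \<in> hom (full_category K) X X"
      using K by (simp add: full_category_def hom_def hdts_map_id)
  next
    fix X Y Z g h
    assume "g \<in> hom (full_category K) X Y" "h \<in> hom (full_category K) Y Z"
    then show "cmp (full_category K) h g \<in> hom (full_category K) X Z"
      using K by (auto simp: full_category_def hom_def intro!: hdts_map_compose)
  next
    fix X Y g assume g: "g \<in> hom (full_category K) X Y"
    then have m: "hdts_map (source g) (target g) (st g) (ac g)" "source g = X" "target g = Y"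
      by (auto simp: full_category_def hom_def)
    show "cmp (full_category K) g (ident (full_category K) X) = g"
      using f[OF m(1)] m(2,3) by (simp add: full_category_def compose_Id)
    show "cmp (full_category K) (ident (full_category K) Y) g = g"
      using f[OF m(1)] m(2,3) by (simp add: full_category_def Id_compose)
  next
    fix V X Y Z g h k
    assume g: "g \<in> hom (full_category K) V X" and h: "h \<in> hom (full_category K) X Y"
      and k: "k \<in> hom (full_category K) Y Z"
    then have m: "hdts_map (source g) (target g) (st g) (ac g)" "target g = source h"
      by (auto simp: full_category_def hom_def)
    show "cmp (full_category K) k (cmp (full_category K) h g) =
        cmp (full_category K) (cmp (full_category K) k h) g"
      using compose_assoc[OF f(1)[OF m(1)], of "st k" "st h"]
        compose_assoc[OF f(3)[OF m(1)], of "ac k" "ac h"] m(2)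
      by (simp add: full_category_def)
  qed
qed

lemma category_WHDTS: "category WHDTS"
  unfolding WHDTS_def by (rule category_full_category) auto

lemma mono_arrow_WHDTS_iff:
  fixes f :: "('u, 'u, 'l) hdts_arrow"
  assumes inf: "infinite (UNIV :: 'u set)" and f: "f \<in> Ar WHDTS"
  shows "mono_arrow WHDTS f \<longleftrightarrow>
    inj_on (st f) (states (source f)) \<and> inj_on (ac f) (actions (source f))"
proof
  have fin: "small A" if "finite A" for A :: "'u set"
    using inf that unfolding small_def
    by (meson finite_lesspoll_infinite)
  have fm: "hdts_map (source f) (target f) (st f) (ac f)" and fo: "source f \<in> Ob WHDTS"
    using f by (simp_all add: WHDTS_def full_category_def)
  assume m: "mono_arrow WHDTS f"
  show "inj_on (st f) (states (source f)) \<and> inj_on (ac f) (actions (source f))"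
  proof (intro conjI inj_onI)
    fix a b assume ab: "a \<in> states (source f)" "b \<in> states (source f)" "st f a = st f b"
    define P :: "('u, 'u, 'l) hdts" where
      "P = \<lparr>states = {a}, actions = {}, label = (\<lambda>_. undefined), transitions = {}\<rparr>"
    define g where "g c = \<lparr>source = P, target = source f,
      st = (\<lambda>x\<in>{a}. c), ac = (\<lambda>_. undefined)\<rparr>" for c
    have "P \<in> Ob WHDTS"
      by (simp add: WHDTS_def full_category_def P_def whdts_def fin)
    then have h: "g a \<in> hom WHDTS P (source f)" "g b \<in> hom WHDTS P (source f)"
      using ab fo by (auto simp: WHDTS_def full_category_def hom_def g_def hdts_map_def P_def)
    have c: "cmp WHDTS f (g a) = cmp WHDTS f (g b)"
      using ab by (auto simp: WHDTS_def full_category_def g_def P_def compose_def)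
    have "src WHDTS f = source f" by (simp add: WHDTS_def full_category_def)
    with m h c have "g a = g b" unfolding mono_arrow_def by metis
    then have "st (g a) a = st (g b) a" by simp
    then show "a = b" by (simp add: g_def)
  next
    fix a b assume ab: "a \<in> actions (source f)" "b \<in> actions (source f)" "ac f a = ac f b"
    have lab: "label (source f) a = label (source f) b"
      using ab fm unfolding hdts_map_def by metis
    define P :: "('u, 'u, 'l) hdts" where
      "P = \<lparr>states = {}, actions = {a}, label = (\<lambda>x\<in>{a}. label (source f) a), transitions = {}\<rparr>"
    define g where "g c = \<lparr>source = P, target = source f,
      st = (\<lambda>_. undefined), ac = (\<lambda>x\<in>{a}. c)\<rparr>" for c
    have "P \<in> Ob WHDTS"
      by (simp add: WHDTS_def full_category_def P_def whdts_def fin)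
    then have h: "g a \<in> hom WHDTS P (source f)" "g b \<in> hom WHDTS P (source f)"
      using ab fo lab by (auto simp: WHDTS_def full_category_def hom_def g_def hdts_map_def P_def)
    have c: "cmp WHDTS f (g a) = cmp WHDTS f (g b)"
      using ab by (auto simp: WHDTS_def full_category_def g_def P_def compose_def)
    have "src WHDTS f = source f" by (simp add: WHDTS_def full_category_def)
    with m h c have "g a = g b" unfolding mono_arrow_def by metis
    then have "ac (g a) a = ac (g b) a" by simp
    then show "a = b" by (simp add: g_def)
  qed
next
  assume i: "inj_on (st f) (states (source f)) \<and> inj_on (ac f) (actions (source f))"
  have aux: "u = v" if "u \<in> A \<rightarrow>\<^sub>E B" "v \<in> A \<rightarrow>\<^sub>E B" "inj_on h B" "compose A h u = compose A h v"
    for A B :: "'u set" and h u v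
  proof (rule PiE_ext[OF that(1,2)])
    fix x assume x: "x \<in> A"
    have "h (u x) = h (v x)" using fun_cong[OF that(4), of x] x by (simp add: compose_eq)
    moreover have "u x \<in> B" "v x \<in> B" using that(1,2) x by auto
    ultimately show "u x = v x" using that(3) by (simp add: inj_on_eq_iff)
  qed
  show "mono_arrow WHDTS f"
    unfolding mono_arrow_def
  proof (intro conjI f allI impI)
    fix A g h
    assume g: "g \<in> hom WHDTS A (src WHDTS f)" and h: "h \<in> hom WHDTS A (src WHDTS f)"
      and eq: "cmp WHDTS f g = cmp WHDTS f h"
    have s: "source g = A" "source h = A" "target g = source f" "target h = source f"
      "hdts_map A (source f) (st g) (ac g)" "hdts_map A (source f) (st h) (ac h)"
      using g h by (auto simp: WHDTS_def full_category_def hom_def)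
    have "compose (states A) (st f) (st g) = compose (states A) (st f) (st h)"
      "compose (actions A) (ac f) (ac g) = compose (actions A) (ac f) (ac h)"
      using eq s by (simp_all add: WHDTS_def full_category_def)
    then have "st g = st h" "ac g = ac h"
      using aux s(5,6) i unfolding hdts_map_def by blast+
    with s show "g = h" by (intro hdts_arrow.equality) auto
  qed
qed

lemma category_CTS: "category CTS"
  unfolding CTS_def by (rule category_full_category) (auto simp: cubical_def)

end

theory Submission
  imports Defs
begin

text \<open>Call a map of cubical transition systems \<open>X\<close>-local if precomposing with it is a bijection
  on maps to \<open>X\<close>. If \<open>X\<close> satisfies CSA1, then the \<open>X\<close>-local maps form a localizer, so every
  trivial cofibration is \<open>X\<close>-local and therefore lifts against \<open>X \<rightarrow> 1\<close>. The point is that a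
  map \<open>p\<close> with the right lifting property against all cofibrations is bijective on states and
  has a section \<open>s\<close>; as every action of a cubical transition system occurs in a
  \<open>1\<close>-transition, CSA1 forces \<open>g \<circ> s \<circ> p = g\<close> for all maps \<open>g\<close> to \<open>X\<close>.\<close>

section \<open>Transfinite compositions and orthogonality\<close>

text \<open>A localizer asks that the cofibrations inside it be stable under pushout and transfinite
  composition, so two stability statements are needed. For \<open>X\<close>-locality stability is
  formal, because maps into \<open>X\<close> turn colimits into limits. Injectivity on actions is
  the obstacle: a colimit of systems may have to receive transitions that the coherence axiom
  forces, which makes an explicit description unwieldy. The way out is representability. A suitable
  one-state system represents the functor that sends a system to the set of all subsets of its
  actions, so injectivity becomes an extension property that the universal property of a colimit can
  verify. That system has to be small, which is guaranteed by an infinite universe with strictly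
  fewer labels than elements. The roles of states and actions differ throughout: cofibrations may
  identify states, which makes trivial fibrations rigid on states, while on actions a trivial
  fibration may still identify. CSA1 recovers the missing control over actions from the
  states.\<close>

lemma category_cmp_hom:
  "category C \<Longrightarrow> f \<in> hom C A B \<Longrightarrow> g \<in> hom C B D \<Longrightarrow> cmp C g f \<in> hom C A D"
  unfolding category_def by blast

lemma category_assoc:
  "category C \<Longrightarrow> f \<in> hom C A B \<Longrightarrow> g \<in> hom C B D \<Longrightarrow> h \<in> hom C D E \<Longrightarrow>
    cmp C (cmp C h g) f = cmp C h (cmp C g f)"
  unfolding category_def by metis

lemma category_ident:
  assumes "category C" and "f \<in> hom C A B"
  shows "cmp C f (ident C A) = f" "cmp C (ident C B) f = f"
  using assms unfolding category_def by blast+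

lemma category_ident_hom: "category C \<Longrightarrow> A \<in> Ob C \<Longrightarrow> ident C A \<in> hom C A A"
  unfolding category_def by blast

lemma category_hom_Ob: "category C \<Longrightarrow> f \<in> hom C A B \<Longrightarrow> A \<in> Ob C \<and> B \<in> Ob C"
  unfolding category_def hom_def by blast

text \<open>Stability of a class reduces to identities, composites and colimit legs. The index set
  \<open>I\<close> in the last hypothesis lets one statement cover both the colimit below a limit
  element and the colimit over the whole order.\<close>

lemma transfinite_compositionI:
  assumes f: "transfinite_composition C r K f" and wo: "Well_order r"
    and ident: "\<And>A. A \<in> Ob C \<Longrightarrow> ident C A \<in> K"
    and cmp: "\<And>A B D g h. g \<in> hom C A B \<Longrightarrow> h \<in> hom C B D \<Longrightarrow> g \<in> K \<Longrightarrow> h \<in> K \<Longrightarrow> cmp C h g \<in> K"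
    and colim: "\<And>I D d Y c i. I \<subseteq> Field r \<Longrightarrow> diagram C r D d \<Longrightarrow>
      (\<And>i j. i \<in> I \<Longrightarrow> j \<in> I \<Longrightarrow> (i, j) \<in> r \<Longrightarrow> d i j \<in> K) \<Longrightarrow>
      colimit_cocone C r I D d Y c \<Longrightarrow> i \<in> I \<Longrightarrow> c i \<in> K"
  shows "f \<in> K"
proof -
  obtain D d Y c i0 where diag: "diagram C r D d"
      and step: "\<And>i j. covers r i j \<Longrightarrow> d i j \<in> K"
      and lim: "\<And>j. limit_element r j \<Longrightarrow>
        colimit_cocone C r (underS r j) D d (D j) (\<lambda>i. d i j)"
      and Y: "colimit_cocone C r (Field r) D d Y c" "i0 \<in> Field r" "f = c i0"
    using f unfolding transfinite_composition_def by (elim exE conjE) blast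
  have wr: "wo_rel r" using wo by (simp add: wo_rel_def)
  \<comment> \<open>The claim concerns every \<open>i\<close> below \<open>j\<close>, not just the
    least index, because at a limit stage \<open>colim\<close> asks for all arrows among the earlier
    stages.\<close>
  have "\<forall>i. (i, j) \<in> r \<longrightarrow> d i j \<in> K" for j
  proof (induction j rule: wo_rel.well_order_induct[OF wr])
    case (1 j)
    have IH: "d i k \<in> K" if "(i, k) \<in> r" "k \<in> underS r j" for i k
      using 1 that by (auto simp: underS_def)
    show ?case
    proof (intro allI impI)
      fix i assume ij: "(i, j) \<in> r"
      then have fj: "j \<in> Field r" by (auto simp: Field_def)
      show "d i j \<in> K"
      proof (cases "i = j")
        case True
        with diag fj ident show ?thesis unfolding diagram_def by metis
      next
        case False
        with ij have iu: "i \<in> underS r j" by (simp add: underS_def)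
        show ?thesis
        proof (cases "limit_element r j")
          case True
          show ?thesis
          proof (rule colim[OF _ diag _ lim[OF True] iu])
            show "underS r j \<subseteq> Field r" by (auto simp: underS_def Field_def)
          qed (rule IH)
        next
          case False
          with fj iu obtain k where k: "covers r k j" by (auto simp: limit_element_def)
          then have ku: "k \<in> underS r j" and ik: "(i, k) \<in> r" using iu by (auto simp: covers_def)
          have kj: "(k, j) \<in> r" using ku by (simp add: underS_def)
          have "cmp C (d k j) (d i k) \<in> K"
            using diag ik kj by (intro cmp[OF _ _ IH[OF ik ku] step[OF k]]) (auto simp: diagram_def)
          moreover have "cmp C (d k j) (d i k) = d i j"
            using diag ik kj unfolding diagram_def by blast
          ultimately show ?thesis by simp
        qed
      qed
    qed
  qed
  with colim[OF subset_refl diag _ Y(1,2)] Y(3) show ?thesis by blast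
qed

section \<open>Orthogonality to a fixed object\<close>

definition local_equivalences :: "('o, 'm) precat \<Rightarrow> 'o \<Rightarrow> 'm set" where
  "local_equivalences C X =
     {f \<in> Ar C. bij_betw (\<lambda>h. cmp C h f) (hom C (tgt C f) X) (hom C (src C f) X)}"

text \<open>Bijectivity is the form suited to two-out-of-three, unique extension the form suited to
  pushouts and colimits; this passes between them.\<close>

lemma local_equivalences_iff:
  assumes C: "category C" and f: "f \<in> hom C A B"
  shows "f \<in> local_equivalences C X \<longleftrightarrow>
    (\<forall>u\<in>hom C A X. \<exists>!h. h \<in> hom C B X \<and> cmp C h f = u)"
proof -
  have bij: "bij_betw P S T \<longleftrightarrow> (\<forall>u\<in>T. \<exists>!h. h \<in> S \<and> P h = u)" if "P ` S \<subseteq> T"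
    for P :: "'m \<Rightarrow> 'm" and S T
  proof
    assume "bij_betw P S T"
    then show "\<forall>u\<in>T. \<exists>!h. h \<in> S \<and> P h = u" unfolding bij_betw_def inj_on_def by blast
  next
    assume *: "\<forall>u\<in>T. \<exists>!h. h \<in> S \<and> P h = u"
    with that have "inj_on P S" unfolding inj_on_def by blast
    moreover from * that have "P ` S = T" by blast
    ultimately show "bij_betw P S T" by (simp add: bij_betw_def)
  qed
  have "(\<lambda>h. cmp C h f) ` hom C B X \<subseteq> hom C A X"
    using category_cmp_hom[OF C f] by blast
  from bij[OF this] f show ?thesis by (simp add: local_equivalences_def hom_def)
qed

text \<open>Maps into \<open>X\<close> form a contravariant functor to sets, so the claim is
  two-out-of-three for bijections.\<close>

lemma local_equivalences_two_out_of_three: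
  assumes C: "category C"
  shows "two_out_of_three C (local_equivalences C X)"
  unfolding two_out_of_three_def
proof (intro allI impI)
  fix f g assume fg: "f \<in> Ar C" "g \<in> Ar C" "tgt C f = src C g"
  define A B D where "A = src C f" and "B = src C g" and "D = tgt C g"
  have f: "f \<in> hom C A B" and g: "g \<in> hom C B D" using fg by (auto simp: hom_def A_def B_def D_def)
  have gf: "cmp C g f \<in> hom C A D" using category_cmp_hom[OF C f g] .
  let ?P = "\<lambda>k h. cmp C h k"
  have bij: "k \<in> local_equivalences C X \<longleftrightarrow> bij_betw (?P k) (hom C E X) (hom C A X)"
    if "k \<in> hom C A E" for k A E
    using that by (auto simp: local_equivalences_def hom_def)
  have eq: "bij_betw (?P (cmp C g f)) (hom C D X) (hom C A X) \<longleftrightarrow>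
      bij_betw (?P f \<circ> ?P g) (hom C D X) (hom C A X)"
    by (rule bij_betw_cong) (simp add: category_assoc[OF C f g])
  have img: "?P g ` hom C D X \<subseteq> hom C B X" using category_cmp_hom[OF C g] by blast
  show "(f \<in> local_equivalences C X \<and> g \<in> local_equivalences C X \<longrightarrow>
        cmp C g f \<in> local_equivalences C X) \<and>
      (f \<in> local_equivalences C X \<and> cmp C g f \<in> local_equivalences C X \<longrightarrow>
        g \<in> local_equivalences C X) \<and>
      (g \<in> local_equivalences C X \<and> cmp C g f \<in> local_equivalences C X \<longrightarrow>
        f \<in> local_equivalences C X)"
    unfolding bij[OF f] bij[OF g] bij[OF gf] eq
    using bij_betw_comp_iff[of "?P g" "hom C D X" "hom C B X" "?P f" "hom C A X"]
      bij_betw_comp_iff2[OF _ img, of "?P f" "hom C A X"]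
    by blast
qed

lemma local_equivalences_ident:
  assumes C: "category C" and A: "A \<in> Ob C"
  shows "ident C A \<in> local_equivalences C X"
  unfolding local_equivalences_iff[OF C category_ident_hom[OF C A]]
  using category_ident(1)[OF C] by metis

lemma local_equivalences_cmp:
  assumes C: "category C" and "g \<in> hom C A B" "h \<in> hom C B D"
    and "g \<in> local_equivalences C X" "h \<in> local_equivalences C X"
  shows "cmp C h g \<in> local_equivalences C X"
proof -
  have "g \<in> Ar C" "h \<in> Ar C" "tgt C g = src C h" using assms(2,3) by (auto simp: hom_def)
  from local_equivalences_two_out_of_three[OF C, of X, unfolded two_out_of_three_def,
      rule_format, OF this] assms(4,5)
  show ?thesis by blast
qed

text \<open>A map \<open>b\<close> on the corner restricts along \<open>g\<close> to a map that
  extends uniquely over \<open>f\<close>, and this extension glues with \<open>b\<close>. For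
  uniqueness, any \<open>h\<close> with \<open>cmp C h f' = b\<close> makes
  \<open>cmp C h g'\<close> an extension of \<open>cmp C b g\<close> along \<open>f\<close>, so
  \<open>h\<close> is determined on both legs.\<close>

lemma local_equivalences_pushout:
  assumes C: "category C" and f: "f \<in> local_equivalences C X" and po: "pushout C f g f' g'"
  shows "f' \<in> local_equivalences C X"
proof -
  define A B D E where "A = src C f" and "B = tgt C f" and "D = tgt C g" and "E = tgt C f'"
  have homs: "f \<in> hom C A B" "g \<in> hom C A D" "f' \<in> hom C D E" "g' \<in> hom C B E"
    and comm: "cmp C g' f = cmp C f' g"
    using po unfolding pushout_def hom_def A_def B_def D_def E_def by auto
  have univ: "\<And>a b. a \<in> hom C B X \<Longrightarrow> b \<in> hom C D X \<Longrightarrow> cmp C a f = cmp C b g \<Longrightarrow>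
      \<exists>!h. h \<in> hom C E X \<and> cmp C h g' = a \<and> cmp C h f' = b"
    using po unfolding pushout_def A_def B_def D_def E_def by blast
  note f_iff = local_equivalences_iff[OF C homs(1), THEN iffD1, OF f, rule_format]
  show ?thesis
    unfolding local_equivalences_iff[OF C homs(3)]
  proof
    fix b assume b: "b \<in> hom C D X"
    then have bg: "cmp C b g \<in> hom C A X" using category_cmp_hom[OF C homs(2)] by blast
    from f_iff[OF bg] obtain a where a: "a \<in> hom C B X" "cmp C a f = cmp C b g" by blast
    show "\<exists>!h. h \<in> hom C E X \<and> cmp C h f' = b"
    proof (rule ex_ex1I)
      show "\<exists>h. h \<in> hom C E X \<and> cmp C h f' = b" using univ[OF a(1) b a(2)] by blast
    next
      fix h k
      assume h: "h \<in> hom C E X \<and> cmp C h f' = b" and k: "k \<in> hom C E X \<and> cmp C k f' = b"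
      have "cmp C (cmp C x g') f = cmp C b g" "cmp C x g' \<in> hom C B X"
        if "x \<in> hom C E X \<and> cmp C x f' = b" for x
        using that comm category_assoc[OF C homs(1,4)] category_assoc[OF C homs(2,3)]
          category_cmp_hom[OF C homs(4)] by metis+
      then have "cmp C h g' = a" "cmp C k g' = a" using f_iff[OF bg] a h k by metis+
      with univ[OF a(1) b a(2)] h k show "h = k" by blast
    qed
  qed
qed

text \<open>A map \<open>b\<close> on the single stage \<open>i\<close> spreads in exactly one way
  to a cocone with vertex \<open>X\<close>, and the universal property turns this cocone into the
  unique extension of \<open>b\<close> over the colimit.\<close>

lemma local_equivalences_colimit:
  assumes C: "category C" and wo: "Well_order r" and I: "I \<subseteq> Field r"
    and diag: "diagram C r D d"
    and K: "\<And>i j. i \<in> I \<Longrightarrow> j \<in> I \<Longrightarrow> (i, j) \<in> r \<Longrightarrow> d i j \<in> local_equivalences C X"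
    and Y: "colimit_cocone C r I D d Y c" and i: "i \<in> I"
  shows "c i \<in> local_equivalences C X"
proof -
  have wr: "wo_rel r" using wo by (simp add: wo_rel_def)
  have trans: "(a, b) \<in> r \<Longrightarrow> (b, c) \<in> r \<Longrightarrow> (a, c) \<in> r" for a b c
    using wo_rel.TRANS[OF wr] by (meson transD)
  have total: "(a, b) \<in> r \<or> (b, a) \<in> r" if "a \<in> I" "b \<in> I" for a b
    using wo_rel.TOTALS[OF wr] I that by blast
  have refl: "(a, a) \<in> r" if "a \<in> I" for a using total[OF that that] by blast
  have d_hom: "d j k \<in> hom C (D j) (D k)" if "(j, k) \<in> r" for j k
    using diag that by (auto simp: diagram_def)
  have d_cmp: "cmp C (d k l) (d j k) = d j l" if "(j, k) \<in> r" "(k, l) \<in> r" for j k l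
    using diag that unfolding diagram_def by blast
  have c_hom: "c j \<in> hom C (D j) Y" if "j \<in> I" for j
    using Y that by (auto simp: colimit_cocone_def cocone_def)
  have c_cmp: "cmp C (c k) (d j k) = c j" if "j \<in> I" "k \<in> I" "(j, k) \<in> r" for j k
    using Y that by (auto simp: colimit_cocone_def cocone_def)
  have ext: "\<exists>!h. h \<in> hom C (D k) X \<and> cmp C h (d j k) = b"
    if "j \<in> I" "k \<in> I" "(j, k) \<in> r" "b \<in> hom C (D j) X" for j k b
    using K[OF that(1-3)] that(4) unfolding local_equivalences_iff[OF C d_hom[OF that(3)]] by blast
  show ?thesis
    unfolding local_equivalences_iff[OF C c_hom[OF i]]
  proof
    fix b assume b: "b \<in> hom C (D i) X"
    \<comment> \<open>The index set need not begin at \<open>i\<close>: later stages receive the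
      unique extension of \<open>b\<close>, earlier ones its restriction. The index \<open>i\<close>
      itself falls under the first branch, where the diagram arrow is an identity and the value is
      \<open>b\<close>.\<close>
    define e where "e k = (if (i, k) \<in> r then THE h. h \<in> hom C (D k) X \<and> cmp C h (d i k) = b
      else cmp C b (d k i))" for k
    have e1: "e k \<in> hom C (D k) X \<and> cmp C (e k) (d i k) = b" if "k \<in> I" "(i, k) \<in> r" for k
      using theI'[OF ext[OF i that b]] that(2) by (simp add: e_def)
    have e2: "e k \<in> hom C (D k) X \<and> e k = cmp C b (d k i)" if "(k, i) \<in> r" "(i, k) \<notin> r" for k
      using category_cmp_hom[OF C d_hom[OF that(1)] b] that(2) by (simp add: e_def)
    have e_hom: "e k \<in> hom C (D k) X" if "k \<in> I" for k
      using e1[OF that] e2[of k] total[OF i that] by blast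
    have e_cmp: "cmp C (e l) (d k l) = e k" if kl: "k \<in> I" "l \<in> I" "(k, l) \<in> r" for k l
    proof (cases "(i, k) \<in> r")
      case True
      have il: "(i, l) \<in> r" using trans True kl(3) .
      have "cmp C (cmp C (e l) (d k l)) (d i k) = b"
        using category_assoc[OF C d_hom[OF True] d_hom[OF kl(3)] e_hom[OF kl(2)]]
          d_cmp[OF True kl(3)] e1[OF kl(2) il] by simp
      then show ?thesis
        using ext[OF i kl(1) True b] e1[OF kl(1) True]
          category_cmp_hom[OF C d_hom[OF kl(3)] e_hom[OF kl(2)]] by blast
    next
      case False
      then have ki: "(k, i) \<in> r" using total i kl(1) by blast
      show ?thesis
      proof (cases "(i, l) \<in> r")
        case True
        show ?thesis
          using category_assoc[OF C d_hom[OF ki] d_hom[OF True] e_hom[OF kl(2)]]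
            d_cmp[OF ki True] e1[OF kl(2) True] e2[OF ki False] by simp
      next
        case il: False
        then have li: "(l, i) \<in> r" using total i kl(2) by blast
        show ?thesis
          using category_assoc[OF C d_hom[OF kl(3)] d_hom[OF li] b]
            d_cmp[OF kl(3) li] e2[OF ki False] e2[OF li il] by simp
      qed
    qed
    have "X \<in> Ob C" using category_hom_Ob[OF C b] by blast
    then have "cocone C r I D d X e" using e_hom e_cmp by (simp add: cocone_def)
    then obtain h where h: "h \<in> hom C Y X" "\<And>k. k \<in> I \<Longrightarrow> cmp C h (c k) = e k"
      using Y unfolding colimit_cocone_def by blast
    have ei: "e i = b"
      using e1[OF i refl[OF i]] diag category_ident(1)[OF C e_hom[OF i]] i I
      by (auto simp: diagram_def)
    show "\<exists>!h. h \<in> hom C Y X \<and> cmp C h (c i) = b"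
    proof (rule ex1I)
      show "h \<in> hom C Y X \<and> cmp C h (c i) = b" using h i ei by simp
    next
      fix h' assume h': "h' \<in> hom C Y X \<and> cmp C h' (c i) = b"
      have "cmp C h' (c k) = e k" if k: "k \<in> I" for k
      proof (cases "(i, k) \<in> r")
        case True
        have "cmp C (cmp C h' (c k)) (d i k) = b"
          using category_assoc[OF C d_hom[OF True] c_hom[OF k]] h' c_cmp[OF i k True] by metis
        then show ?thesis
          using ext[OF i k True b] e1[OF k True] category_cmp_hom[OF C c_hom[OF k]] h' by blast
      next
        case False
        then have ki: "(k, i) \<in> r" using total i k by blast
        then show ?thesis
          using category_assoc[OF C d_hom[OF ki] c_hom[OF i]] h' c_cmp[OF k i ki]
            e2[OF ki False] by metis
      qed
      with h' h show "h' = h"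
        using Y \<open>cocone C r I D d X e\<close> unfolding colimit_cocone_def by blast
    qed
  qed
qed

section \<open>Cubical transition systems\<close>

lemma whdts_transitionD:
  assumes "whdts X" and "(\<alpha>, us, \<beta>) \<in> transitions X"
  shows "\<alpha> \<in> states X" "\<beta> \<in> states X" "set us \<subseteq> actions X" "us \<noteq> []"
  using assms unfolding whdts_def by (blast, blast, blast, fastforce)

text \<open>The axioms of a weak HDTS are closure conditions and survive intersection, so the image
  is the intersection of all subobjects through which the map factors. It supplies a subcube for
  each map out of a cube.\<close>

lemma is_image_exists:
  assumes X: "whdts X" and f: "hdts_map C X f0 f1"
  shows "\<exists>Y. is_image C X f0 f1 Y"
proof -
  define F where "F = {Z. subobject Z X \<and> hdts_map C Z f0 f1}"
  define Y where "Y = \<lparr>states = (\<Inter>Z\<in>F. states Z), actions = (\<Inter>Z\<in>F. actions Z),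
    label = restrict (label X) (\<Inter>Z\<in>F. actions Z), transitions = (\<Inter>Z\<in>F. transitions Z)\<rparr>"
  have "restrict (label X) (actions X) = label X"
    using X by (simp add: whdts_def extensional_restrict)
  \<comment> \<open>The family has to be nonempty: an intersection over the empty family would be a
    universal set instead of a part of \<open>X\<close>.\<close>
  then have XF: "X \<in> F" using X f by (simp add: F_def subobject_def)
  have W: "whdts Z" if "Z \<in> F" for Z using that by (simp add: F_def subobject_def)
  have "whdts Y"
    unfolding whdts_def
  proof (intro conjI allI impI)
    show "label Y \<in> extensional (actions Y)" by (simp add: Y_def)
  next
    fix \<alpha> us \<beta> assume "(\<alpha>, us, \<beta>) \<in> transitions Y"
    then have *: "(\<alpha>, us, \<beta>) \<in> transitions Z" if "Z \<in> F" for Z using that by (simp add: Y_def)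
    have "\<alpha> \<in> states Z \<and> \<beta> \<in> states Z \<and> set us \<subseteq> actions Z \<and> length us \<ge> 1" if "Z \<in> F" for Z
      using *[OF that] W[OF that] unfolding whdts_def by blast
    with XF show "\<alpha> \<in> states Y" "\<beta> \<in> states Y" "set us \<subseteq> actions Y" "length us \<ge> 1"
      by (auto simp: Y_def)
  next
    fix \<alpha> us \<beta> \<sigma>
    assume "(\<alpha>, us, \<beta>) \<in> transitions Y" and s: "2 \<le> length us" "\<sigma> permutes {..<length us}"
    then have *: "(\<alpha>, us, \<beta>) \<in> transitions Z" if "Z \<in> F" for Z using that by (simp add: Y_def)
    have "(\<alpha>, permute_list \<sigma> us, \<beta>) \<in> transitions Z" if "Z \<in> F" for Z
      using *[OF that] W[OF that] s unfolding whdts_def by blast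
    then show "(\<alpha>, permute_list \<sigma> us, \<beta>) \<in> transitions Y" by (simp add: Y_def)
  next
    fix \<alpha> \<beta> \<nu>1 \<nu>2 us vs ws
    assume ne: "us \<noteq> []" "vs \<noteq> []" "ws \<noteq> []" and
      "(\<alpha>, us @ vs @ ws, \<beta>) \<in> transitions Y" "(\<alpha>, us, \<nu>1) \<in> transitions Y"
      "(\<nu>1, vs @ ws, \<beta>) \<in> transitions Y" "(\<alpha>, us @ vs, \<nu>2) \<in> transitions Y"
      "(\<nu>2, ws, \<beta>) \<in> transitions Y"
    then have *: "(\<alpha>, us @ vs @ ws, \<beta>) \<in> transitions Z" "(\<alpha>, us, \<nu>1) \<in> transitions Z"
      "(\<nu>1, vs @ ws, \<beta>) \<in> transitions Z" "(\<alpha>, us @ vs, \<nu>2) \<in> transitions Z"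
      "(\<nu>2, ws, \<beta>) \<in> transitions Z" if "Z \<in> F" for Z using that by (auto simp: Y_def)
    have "(\<nu>1, vs, \<nu>2) \<in> transitions Z" if "Z \<in> F" for Z
      using *[OF that] W[OF that] ne unfolding whdts_def by blast
    then show "(\<nu>1, vs, \<nu>2) \<in> transitions Y" by (simp add: Y_def)
  qed
  moreover have "subobject Y Z" if "Z \<in> F" for Z
  proof -
    have "label Z = restrict (label X) (actions Z)"
      using that by (simp add: F_def subobject_def)
    then have "restrict (label Z) (actions Y) = restrict (label X) (actions Y)"
      using that by (auto simp: restrict_def Y_def fun_eq_iff)
    with \<open>whdts Y\<close> that show ?thesis by (auto simp: subobject_def Y_def)
  qed
  moreover have "hdts_map C Y f0 f1"
    unfolding hdts_map_def
  proof (intro conjI ballI allI impI)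
    have F: "f0 \<in> states C \<rightarrow>\<^sub>E states Z" "f1 \<in> actions C \<rightarrow>\<^sub>E actions Z"
      "\<And>\<alpha> us \<beta>. (\<alpha>, us, \<beta>) \<in> transitions C \<Longrightarrow> (f0 \<alpha>, map f1 us, f0 \<beta>) \<in> transitions Z"
      if "Z \<in> F" for Z using that by (simp_all add: F_def hdts_map_def)
    show "f0 \<in> states C \<rightarrow>\<^sub>E states Y" "f1 \<in> actions C \<rightarrow>\<^sub>E actions Y"
      using F(1,2) XF by (fastforce simp: Y_def PiE_iff)+
    then show "label Y (f1 u) = label C u" if "u \<in> actions C" for u
      using f that by (auto simp: hdts_map_def Y_def)
    show "(f0 \<alpha>, map f1 us, f0 \<beta>) \<in> transitions Y" if "(\<alpha>, us, \<beta>) \<in> transitions C" for \<alpha> us \<beta>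
      using F(3) that by (simp add: Y_def)
  qed
  ultimately show ?thesis using XF by (auto simp: is_image_def F_def)
qed

text \<open>If every transition comes from a cube, the subcubes already cover \<open>X\<close>
  componentwise: states come from 0-cubes, and actions from the transitions that use them. A
  subobject containing all subcubes is therefore all of \<open>X\<close>.\<close>

lemma cubicalI:
  assumes X: "whdts X"
    and act: "\<And>u. u \<in> actions X \<Longrightarrow> \<exists>\<alpha> us \<beta>. (\<alpha>, us, \<beta>) \<in> transitions X \<and> u \<in> set us"
    and cub: "\<And>\<alpha> us \<beta>. (\<alpha>, us, \<beta>) \<in> transitions X \<Longrightarrow>
      \<exists>xs f0 f1 \<epsilon> vs \<epsilon>'. hdts_map (cube xs) X f0 f1 \<and> (\<epsilon>, vs, \<epsilon>') \<in> transitions (cube xs) \<and>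
        f0 \<epsilon> = \<alpha> \<and> map f1 vs = us \<and> f0 \<epsilon>' = \<beta>"
  shows "cubical X"
  unfolding cubical_def is_union_def
proof (intro conjI ballI allI impI X)
  have lab: "restrict (label X) (actions X) = label X"
    using X by (simp add: whdts_def extensional_restrict)
  then show "subobject X X" using X by (simp add: subobject_def)
  show "subobject A X" if "A \<in> subcubes X" for A
    using that by (auto simp: subcubes_def is_image_def)
  fix Z assume Z: "subobject Z X" and sub: "\<forall>A\<in>subcubes X. subobject A Z"
  have map: "f0 \<in> states (cube xs) \<rightarrow> states Z \<and>
      (\<forall>\<epsilon> vs \<epsilon>'. (\<epsilon>, vs, \<epsilon>') \<in> transitions (cube xs) \<longrightarrow> (f0 \<epsilon>, map f1 vs, f0 \<epsilon>') \<in> transitions Z)"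
    if f: "hdts_map (cube xs) X f0 f1" for xs f0 f1
  proof -
    obtain A where A: "is_image (cube xs) X f0 f1 A" using is_image_exists[OF X f] by blast
    then have "A \<in> subcubes X" using f by (auto simp: subcubes_def)
    then have "subobject A Z" using sub by blast
    moreover have "hdts_map (cube xs) A f0 f1" using A by (simp add: is_image_def)
    ultimately show ?thesis by (fastforce simp: subobject_def hdts_map_def PiE_iff)
  qed
  have "states X \<subseteq> states Z"
  proof
    fix s assume "s \<in> states X"
    \<comment> \<open>The 0-cube has the single vertex \<open>[]\<close>, no actions and no
      transitions, so any state of \<open>X\<close> is its image.\<close>
    then have "hdts_map (cube []) X (\<lambda>x\<in>{[]}. s) (\<lambda>_. undefined)"
      by (auto simp: hdts_map_def cube_def)
    from map[OF this] show "s \<in> states Z" by (simp add: cube_def)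
  qed
  moreover have tr: "transitions X \<subseteq> transitions Z" using cub map by fastforce
  moreover have "actions X \<subseteq> actions Z"
  proof
    fix u assume "u \<in> actions X"
    then obtain \<alpha> us \<beta> where "(\<alpha>, us, \<beta>) \<in> transitions Z" "u \<in> set us" using act tr by blast
    moreover have "whdts Z" using Z by (simp add: subobject_def)
    ultimately show "u \<in> actions Z" using whdts_transitionD(3)[of Z] by blast
  qed
  ultimately show "subobject X Z" using X Z lab by (auto simp: subobject_def)
qed

text \<open>Minimality of the union takes the place of a description of its elements: the actions
  occurring in 1-transitions span a subobject \<open>Y\<close>, every subcube lies in
  \<open>Y\<close>, and hence so does \<open>X\<close>.\<close>

lemma cubical_action_transition:
  assumes X: "cubical X" and u: "u \<in> actions X"
  shows "\<exists>\<alpha> \<beta>. (\<alpha>, [u], \<beta>) \<in> transitions X"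
proof -
  have wX: "whdts X" using X by (simp add: cubical_def)
  define U where "U = {u. \<exists>\<alpha> \<beta>. (\<alpha>, [u], \<beta>) \<in> transitions X}"
  define Y where "Y = \<lparr>states = states X, actions = U, label = restrict (label X) U,
    transitions = {(\<alpha>, us, \<beta>). (\<alpha>, us, \<beta>) \<in> transitions X \<and> set us \<subseteq> U}\<rparr>"
  have U: "U \<subseteq> actions X" using whdts_transitionD(3)[OF wX] by (fastforce simp: U_def)
  have "whdts Y"
    unfolding whdts_def
  proof (intro conjI allI impI)
    show "label Y \<in> extensional (actions Y)" by (simp add: Y_def)
  next
    fix \<alpha> us \<beta> assume t: "(\<alpha>, us, \<beta>) \<in> transitions Y"
    then have "(\<alpha>, us, \<beta>) \<in> transitions X" by (simp add: Y_def)
    with wX have "\<alpha> \<in> states X \<and> \<beta> \<in> states X \<and> length us \<ge> 1" unfolding whdts_def by blast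
    with t show "\<alpha> \<in> states Y" "\<beta> \<in> states Y" "set us \<subseteq> actions Y" "length us \<ge> 1"
      by (auto simp: Y_def)
  next
    fix \<alpha> us \<beta> \<sigma>
    assume t: "(\<alpha>, us, \<beta>) \<in> transitions Y" and s: "2 \<le> length us" "\<sigma> permutes {..<length us}"
    have "(\<alpha>, us, \<beta>) \<in> transitions X" using t by (simp add: Y_def)
    with wX s have "(\<alpha>, permute_list \<sigma> us, \<beta>) \<in> transitions X" unfolding whdts_def by blast
    with t s show "(\<alpha>, permute_list \<sigma> us, \<beta>) \<in> transitions Y" by (simp add: Y_def)
  next
    fix \<alpha> \<beta> \<nu>1 \<nu>2 us vs ws
    assume ne: "us \<noteq> []" "vs \<noteq> []" "ws \<noteq> []" and t:
      "(\<alpha>, us @ vs @ ws, \<beta>) \<in> transitions Y" "(\<alpha>, us, \<nu>1) \<in> transitions Y"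
      "(\<nu>1, vs @ ws, \<beta>) \<in> transitions Y" "(\<alpha>, us @ vs, \<nu>2) \<in> transitions Y"
      "(\<nu>2, ws, \<beta>) \<in> transitions Y"
    then have "(\<alpha>, us @ vs @ ws, \<beta>) \<in> transitions X" "(\<alpha>, us, \<nu>1) \<in> transitions X"
      "(\<nu>1, vs @ ws, \<beta>) \<in> transitions X" "(\<alpha>, us @ vs, \<nu>2) \<in> transitions X"
      "(\<nu>2, ws, \<beta>) \<in> transitions X" by (simp_all add: Y_def)
    then have "(\<nu>1, vs, \<nu>2) \<in> transitions X" using wX ne unfolding whdts_def by blast
    with t(1) show "(\<nu>1, vs, \<nu>2) \<in> transitions Y" by (simp add: Y_def)
  qed
  then have Y: "subobject Y X" using U by (auto simp: subobject_def Y_def)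
  have "subobject A Y" if AX: "A \<in> subcubes X" for A
  proof -
    obtain xs f0 f1 where f: "hdts_map (cube xs) X f0 f1" and A: "is_image (cube xs) X f0 f1 A"
      using AX unfolding subcubes_def by blast
    have fU: "f1 v \<in> U" if v: "v \<in> actions (cube xs)" for v
    proof -
      obtain i where i: "v = (xs ! i, i)" "i < length xs" using v by (auto simp: cube_def)
      \<comment> \<open>The edge of the cube that leaves the vertex \<open>?z\<close> in direction
        \<open>i\<close> is a 1-transition whose action is \<open>v\<close>.\<close>
      let ?z = "replicate (length xs) False"
      have "(?z, map (\<lambda>i. (xs ! i, i)) [i], ?z[i := True]) \<in> transitions (cube xs)"
        using i(2) by (simp add: cube_def) (rule exI[of _ "[i]"], auto simp: nth_list_update)
      then have "(f0 ?z, map f1 (map (\<lambda>i. (xs ! i, i)) [i]), f0 (?z[i := True])) \<in> transitions X"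
        using f unfolding hdts_map_def by blast
      then have "(f0 ?z, [f1 v], f0 (?z[i := True])) \<in> transitions X" using i(1) by simp
      then show ?thesis by (auto simp: U_def)
    qed
    have "hdts_map (cube xs) Y f0 f1"
      unfolding hdts_map_def
    proof (intro conjI ballI allI impI)
      show "f0 \<in> states (cube xs) \<rightarrow>\<^sub>E states Y" using f by (simp add: hdts_map_def Y_def)
      show "f1 \<in> actions (cube xs) \<rightarrow>\<^sub>E actions Y"
        using f fU by (auto simp: hdts_map_def Y_def PiE_iff)
      show "label Y (f1 v) = label (cube xs) v" if "v \<in> actions (cube xs)" for v
        using f fU[OF that] that by (simp add: hdts_map_def Y_def)
      fix \<epsilon> vs \<epsilon>' assume t: "(\<epsilon>, vs, \<epsilon>') \<in> transitions (cube xs)"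
      then have "set vs \<subseteq> actions (cube xs)" by (rule whdts_transitionD(3)[OF whdts_cube])
      then have "set (map f1 vs) \<subseteq> U" using fU by auto
      with t f show "(f0 \<epsilon>, map f1 vs, f0 \<epsilon>') \<in> transitions Y"
        by (simp add: hdts_map_def Y_def)
    qed
    with A Y show ?thesis by (simp add: is_image_def)
  qed
  with X Y have "subobject X Y" by (simp add: cubical_def is_union_def)
  then have "actions X \<subseteq> U" by (simp add: subobject_def Y_def)
  with u show ?thesis by (auto simp: U_def)
qed

section \<open>Systems without actions and systems with one state\<close>

definition discrete :: "'s set \<Rightarrow> ('s, 'a, 'l) hdts" where
  "discrete S = \<lparr>states = S, actions = {}, label = (\<lambda>_. undefined), transitions = {}\<rparr>"

lemma discrete_simps [simp]:
  "states (discrete S) = S" "actions (discrete S) = {}" "transitions (discrete S) = {}"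
  by (simp_all add: discrete_def)

lemma cubical_discrete: "cubical (discrete S)"
  by (rule cubicalI) (auto simp: whdts_def discrete_def)

lemma hdts_map_discrete:
  "hdts_map (discrete S) X f0 f1 \<longleftrightarrow> f0 \<in> S \<rightarrow>\<^sub>E states X \<and> f1 = (\<lambda>_. undefined)"
  by (auto simp: hdts_map_def)

text \<open>A map into this system amounts to a label-preserving map on actions
  (\<open>hdts_map_chaotic\<close>). Two choices of \<open>U\<close> matter: one action for each
  label gives the terminal object, two for each label give a detector for sets of actions.\<close>

definition chaotic :: "'s \<Rightarrow> 'a set \<Rightarrow> ('a \<Rightarrow> 'l) \<Rightarrow> ('s, 'a, 'l) hdts" where
  "chaotic s U l = \<lparr>states = {s}, actions = U, label = restrict l U,
    transitions = {(s, us, s) | us. us \<noteq> [] \<and> set us \<subseteq> U}\<rparr>"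

lemma chaotic_simps [simp]:
  "states (chaotic s U l) = {s}" "actions (chaotic s U l) = U"
  by (simp_all add: chaotic_def)

lemma whdts_chaotic: "whdts (chaotic s U l)"
  unfolding whdts_def
proof (intro conjI allI impI)
  fix \<alpha> us \<beta> \<sigma>
  assume t: "(\<alpha>, us, \<beta>) \<in> transitions (chaotic s U l)" and s: "\<sigma> permutes {..<length us}"
  have "permute_list \<sigma> us \<noteq> []" if "us \<noteq> []"
    using that by (metis length_permute_list length_0_conv)
  with t s show "(\<alpha>, permute_list \<sigma> us, \<beta>) \<in> transitions (chaotic s U l)"
    by (simp add: chaotic_def)
qed (auto simp: chaotic_def Suc_le_eq)

lemma hdts_map_chaotic:
  assumes X: "whdts X"
  shows "hdts_map X (chaotic s U l) f0 f1 \<longleftrightarrow>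
    f0 = (\<lambda>x\<in>states X. s) \<and> f1 \<in> actions X \<rightarrow>\<^sub>E U \<and> (\<forall>u\<in>actions X. l (f1 u) = label X u)"
    (is "?L \<longleftrightarrow> ?R")
proof
  assume L: ?L
  have f0: "f0 \<in> states X \<rightarrow>\<^sub>E {s}" and f1: "f1 \<in> actions X \<rightarrow>\<^sub>E U" using L by (auto simp: hdts_map_def)
  have "f0 = (\<lambda>x\<in>states X. s)" using f0 by (intro ext) (auto simp: PiE_iff extensional_def)
  moreover have "l (f1 u) = label X u" if "u \<in> actions X" for u
  proof -
    have "f1 u \<in> U" using f1 that by auto
    then have "l (f1 u) = label (chaotic s U l) (f1 u)" by (simp add: chaotic_def)
    with L that show ?thesis by (simp add: hdts_map_def)
  qed
  ultimately show ?R using f1 by blast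
next
  assume R: ?R
  have "(f0 \<alpha>, map f1 us, f0 \<beta>) \<in> transitions (chaotic s U l)"
    if t: "(\<alpha>, us, \<beta>) \<in> transitions X" for \<alpha> us \<beta>
  proof -
    have "\<alpha> \<in> states X" "\<beta> \<in> states X" "set us \<subseteq> actions X" "us \<noteq> []"
      using whdts_transitionD[OF X t] by blast+
    with R show ?thesis by (auto simp: chaotic_def)
  qed
  moreover have "label (chaotic s U l) (f1 u) = label X u" if "u \<in> actions X" for u
    using R that by (auto simp: chaotic_def)
  moreover have "f0 \<in> states X \<rightarrow>\<^sub>E {s}" using R by auto
  ultimately show ?L using R by (simp add: hdts_map_def)
qed

text \<open>A transition with word \<open>us\<close> is the image of the long diagonal of the cube
  labelled by \<open>map l us\<close>. Preservation of labels is the only condition on the action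
  part of a map into a chaotic system, so the axis with index \<open>i\<close> may be sent to
  \<open>us ! i\<close>.\<close>

lemma cubical_chaotic: "cubical (chaotic s U l)"
proof (rule cubicalI[OF whdts_chaotic])
  fix u assume "u \<in> actions (chaotic s U l)"
  then have "(s, [u], s) \<in> transitions (chaotic s U l)" by (simp add: chaotic_def)
  then show "\<exists>\<alpha> us \<beta>. (\<alpha>, us, \<beta>) \<in> transitions (chaotic s U l) \<and> u \<in> set us"
    by (meson list.set_intros(1))
next
  fix \<alpha> us \<beta> assume "(\<alpha>, us, \<beta>) \<in> transitions (chaotic s U l)"
  then have us: "\<alpha> = s" "\<beta> = s" "us \<noteq> []" "set us \<subseteq> U" by (auto simp: chaotic_def)
  define n where "n = length us"
  define xs where "xs = map l us"
  define f0 where "f0 = (\<lambda>x\<in>states (cube xs). s)"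
  define f1 where "f1 = (\<lambda>(x, i)\<in>actions (cube xs). us ! i)"
  have n: "length xs = n" by (simp add: xs_def n_def)
  have "hdts_map (cube xs) (chaotic s U l) f0 f1"
    unfolding hdts_map_chaotic[OF whdts_cube]
    using us(4) by (auto simp: f0_def f1_def cube_def n n_def xs_def)
  moreover have
    "(replicate n False, map (\<lambda>i. (xs ! i, i)) [0..<n], replicate n True) \<in> transitions (cube xs)"
    using us(3) unfolding cube_def by (fastforce simp: n n_def)
  moreover have "f0 (replicate n False) = \<alpha>" "f0 (replicate n True) = \<beta>"
    using us by (simp_all add: f0_def cube_def n)
  moreover have "map f1 (map (\<lambda>i. (xs ! i, i)) [0..<n]) = us"
    by (rule nth_equalityI) (auto simp: f1_def cube_def n n_def xs_def)
  ultimately show "\<exists>xs f0 f1 \<epsilon> vs \<epsilon>'. hdts_map (cube xs) (chaotic s U l) f0 f1 \<and>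
      (\<epsilon>, vs, \<epsilon>') \<in> transitions (cube xs) \<and> f0 \<epsilon> = \<alpha> \<and> map f1 vs = us \<and> f0 \<epsilon>' = \<beta>"
    by blast
qed

section \<open>Cofibrations\<close>

lemma Ob_CTS: "X \<in> Ob CTS \<longleftrightarrow> cubical X \<and> small (states X) \<and> small (actions X)"
  by (simp add: CTS_def full_category_def)

lemma hom_CTS:
  "f \<in> hom CTS X Y \<longleftrightarrow> X \<in> Ob CTS \<and> Y \<in> Ob CTS \<and> source f = X \<and> target f = Y \<and>
    hdts_map X Y (st f) (ac f)"
  by (auto simp: CTS_def full_category_def hom_def)

lemma CTS_simps [simp]:
  "src CTS f = source f" "tgt CTS f = target f"
  "source (cmp CTS g f) = source f" "target (cmp CTS g f) = target g"
  "st (cmp CTS g f) = compose (states (source f)) (st g) (st f)"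
  "ac (cmp CTS g f) = compose (actions (source f)) (ac g) (ac f)"
  by (simp_all add: CTS_def full_category_def)

lemma ident_CTS_simps [simp]:
  "st (ident CTS X) = restrict (\<lambda>x. x) (states X)"
  "ac (ident CTS X) = restrict (\<lambda>x. x) (actions X)"
  by (simp_all add: CTS_def full_category_def)

lemma Ar_CTS: "f \<in> Ar CTS \<longleftrightarrow> f \<in> hom CTS (source f) (target f)"
  by (simp add: hom_def)

lemma hom_CTS_eqI:
  assumes "f \<in> hom CTS X Y" "g \<in> hom CTS X Y"
    and "\<And>x. x \<in> states X \<Longrightarrow> st f x = st g x" "\<And>u. u \<in> actions X \<Longrightarrow> ac f u = ac g u"
  shows "f = g"
proof (rule hdts_arrow.equality)
  have m: "hdts_map X Y (st f) (ac f)" "hdts_map X Y (st g) (ac g)" using assms by (auto simp: hom_CTS)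
  show "st f = st g"
    using m assms(3) unfolding hdts_map_def by (intro PiE_ext[of "st f" "states X"]) auto
  show "ac f = ac g"
    using m assms(4) unfolding hdts_map_def by (intro PiE_ext[of "ac f" "actions X"]) auto
qed (use assms in \<open>auto simp: hom_CTS\<close>)

lemma cofibrations_iff:
  "f \<in> hom CTS X Y \<Longrightarrow> f \<in> cofibrations \<longleftrightarrow> inj_on (ac f) (actions X)"
  by (auto simp: cofibrations_def hom_def)

lemma hom_CTS_mem:
  assumes "f \<in> hom CTS X Y"
  shows "x \<in> states X \<Longrightarrow> st f x \<in> states Y" "u \<in> actions X \<Longrightarrow> ac f u \<in> actions Y"
    "u \<in> actions X \<Longrightarrow> label Y (ac f u) = label X u"
    "(\<alpha>, us, \<beta>) \<in> transitions X \<Longrightarrow> (st f \<alpha>, map (ac f) us, st f \<beta>) \<in> transitions Y"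
  using assms by (auto simp: hom_CTS hdts_map_def)

section \<open>Smallness and the test system for actions\<close>

lemma small_finite:
  assumes "infinite (UNIV :: 'u set)" and "finite A"
  shows "small (A :: 'u set)"
  using assms by (simp add: small_def finite_lesspoll_infinite)

lemma small_range:
  fixes e :: "'l \<Rightarrow> 'u"
  assumes "(UNIV :: 'l set) \<prec> (UNIV :: 'u set)"
  shows "small (range e)"
  unfolding small_def using image_lepoll assms by (rule lesspoll_trans1)

text \<open>Smallness is a strict cardinality bound, so two copies of the label set must still stay
  below the universe. Doubling preserves an infinite cardinality, and a finite set stays finite
  below an infinite universe.\<close>

lemma times_bool_lesspoll:
  includes cardinal_syntax
  assumes u: "infinite (UNIV :: 'u set)" and l: "(UNIV :: 'l set) \<prec> (UNIV :: 'u set)"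
  shows "(UNIV :: ('l \<times> bool) set) \<prec> (UNIV :: 'u set)"
proof (cases "finite (UNIV :: 'l set)")
  case True
  then have "finite (UNIV :: ('l \<times> bool) set)" by (simp add: finite_prod)
  with u show ?thesis by (simp add: finite_lesspoll_infinite)
next
  case False
  then have "(UNIV :: bool set) \<lesssim> (UNIV :: 'l set)" by (simp add: finite_lepoll_infinite)
  then have "|UNIV :: bool set| \<le>o |UNIV :: 'l set|" by (simp add: lepoll_def flip: card_of_ordLeq)
  with False have "|(UNIV :: 'l set) \<times> (UNIV :: bool set)| =o |UNIV :: 'l set|"
    by (intro card_of_Times_infinite_simps) auto
  then have "(UNIV :: ('l \<times> bool) set) \<approx> (UNIV :: 'l set)"
    by (simp add: eqpoll_def card_of_ordIso)
  with l show ?thesis by (blast intro: eq_lesspoll_trans)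
qed

lemma chaotic_Ob:
  assumes "infinite (UNIV :: 'u set)" and "small U"
  shows "chaotic (s :: 'u) U l \<in> Ob CTS"
  using assms by (simp add: Ob_CTS cubical_chaotic small_finite)

text \<open>Colimits are not computed explicitly: injectivity on actions is tested by mapping to a
  one-state system with two actions for each label, encoded as elements of \<open>'u\<close> by \<open>e\<close>.\<close>

definition twofold :: "('l \<times> bool \<Rightarrow> 'u) \<Rightarrow> ('u, 'u, 'l) hdts" where
  "twofold e = chaotic undefined (range e) (fst \<circ> inv e)"

text \<open>The label of an action determines its image in \<open>twofold e\<close> up to one bit,
  so arrows from \<open>A\<close> to \<open>twofold e\<close> are the same as sets of actions of
  \<open>A\<close>, here given by \<open>P\<close>. Precomposition becomes preimage of sets, as
  \<open>indicator_arrow_cmp\<close> records.\<close>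

definition indicator_arrow ::
    "('l \<times> bool \<Rightarrow> 'u) \<Rightarrow> ('u, 'u, 'l) hdts \<Rightarrow> ('u \<Rightarrow> bool) \<Rightarrow> ('u, 'u, 'l) hdts_arrow" where
  "indicator_arrow e A P = \<lparr>source = A, target = twofold e,
     st = (\<lambda>x\<in>states A. undefined), ac = (\<lambda>u\<in>actions A. e (label A u, P u))\<rparr>"

context
  fixes e :: "'l \<times> bool \<Rightarrow> 'u"
  assumes inf: "infinite (UNIV :: 'u set)" and e: "inj e" and small_e: "small (range e)"
begin

lemma twofold_Ob: "twofold e \<in> Ob CTS"
  unfolding twofold_def using inf small_e by (rule chaotic_Ob)

lemma indicator_arrow_hom: "A \<in> Ob CTS \<Longrightarrow> indicator_arrow e A P \<in> hom CTS A (twofold e)"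
  using twofold_Ob e
  by (auto simp: hom_CTS indicator_arrow_def twofold_def Ob_CTS cubical_def hdts_map_chaotic)

lemma indicator_arrow_cmp:
  assumes f: "f \<in> hom CTS A B" and PQ: "\<And>u. u \<in> actions A \<Longrightarrow> Q (ac f u) = P u"
  shows "cmp CTS (indicator_arrow e B Q) f = indicator_arrow e A P"
proof -
  have AB: "A \<in> Ob CTS" "B \<in> Ob CTS" "source f = A" using f by (auto simp: hom_CTS)
  show ?thesis
    by (rule hom_CTS_eqI[OF category_cmp_hom[OF category_CTS f indicator_arrow_hom[OF AB(2)]]
          indicator_arrow_hom[OF AB(1)]])
      (use hom_CTS_mem[OF f] AB(3) PQ in \<open>auto simp: indicator_arrow_def compose_eq\<close>)
qed

text \<open>When the singleton of \<open>u\<close> is a preimage under \<open>ac f\<close>, no other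
  action is sent where \<open>u\<close> is sent. The criterion asks only for maps out of the target
  of \<open>f\<close>, which is what universal properties of colimits provide.\<close>

lemma cofibrationI:
  assumes f: "f \<in> hom CTS A B"
    and sep: "\<And>u. u \<in> actions A \<Longrightarrow> \<exists>P h. cmp CTS h f = indicator_arrow e A P \<and>
      (\<forall>v\<in>actions A. P v \<longleftrightarrow> v = u)"
  shows "f \<in> cofibrations"
  unfolding cofibrations_iff[OF f]
proof (rule inj_onI)
  fix u v assume uv: "u \<in> actions A" "v \<in> actions A" "ac f u = ac f v"
  obtain P h where h: "cmp CTS h f = indicator_arrow e A P" and P: "\<forall>v\<in>actions A. P v \<longleftrightarrow> v = u"
    using sep[OF uv(1)] by blast
  have s: "source f = A" using f by (simp add: hom_CTS)
  have "ac h (ac f w) = e (label A w, P w)" if "w \<in> actions A" for w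
    using arg_cong[OF h, of "\<lambda>k. ac k w"] that s by (simp add: indicator_arrow_def compose_eq)
  with uv have "e (label A u, P u) = e (label A v, P v)" by metis
  with e have "P u = P v" by (simp add: inj_eq)
  with P uv show "u = v" by auto
qed

lemma cofibrations_pushout:
  fixes f :: "('u, 'u, 'l) hdts_arrow"
  assumes f: "f \<in> cofibrations" and po: "pushout CTS f g f' g'"
  shows "f' \<in> cofibrations"
proof -
  define A B D E where "A = source f" and "B = target f" and "D = target g" and "E = target f'"
  have homs: "f \<in> hom CTS A B" "g \<in> hom CTS A D" "f' \<in> hom CTS D E"
    using po unfolding pushout_def hom_def A_def B_def D_def E_def by auto
  have univ: "\<And>Z a b. a \<in> hom CTS B Z \<Longrightarrow> b \<in> hom CTS D Z \<Longrightarrow> cmp CTS a f = cmp CTS b g \<Longrightarrow>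
      \<exists>h. cmp CTS h f' = b"
    using po unfolding pushout_def A_def B_def D_def E_def CTS_simps by blast
  have inj: "inj_on (ac f) (actions A)" using f cofibrations_iff[OF homs(1)] by blast
  have Ob: "B \<in> Ob CTS" "D \<in> Ob CTS" using homs by (auto simp: hom_CTS)
  show ?thesis
  proof (rule cofibrationI[OF homs(3)])
    fix u assume "u \<in> actions D"
    define P where "P v \<longleftrightarrow> v = u" for v
    \<comment> \<open>The fibre of \<open>g\<close> over \<open>u\<close>, pushed forward along
      \<open>f\<close>. As \<open>f\<close> is injective on actions, pulling \<open>Q\<close> back
      along \<open>f\<close> returns exactly this fibre, so the indicators of \<open>Q\<close> and
      \<open>P\<close> agree on \<open>A\<close> and glue.\<close>
    define Q where "Q y \<longleftrightarrow> (\<exists>x\<in>actions A. ac f x = y \<and> ac g x = u)" for y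
    have "cmp CTS (indicator_arrow e B Q) f = indicator_arrow e A (\<lambda>x. ac g x = u)"
      by (rule indicator_arrow_cmp[OF homs(1)]) (use inj in \<open>auto simp: Q_def dest: inj_onD\<close>)
    moreover have "cmp CTS (indicator_arrow e D P) g = indicator_arrow e A (\<lambda>x. ac g x = u)"
      by (rule indicator_arrow_cmp[OF homs(2)]) (simp add: P_def)
    ultimately obtain h where "cmp CTS h f' = indicator_arrow e D P"
      using univ[OF indicator_arrow_hom[OF Ob(1)] indicator_arrow_hom[OF Ob(2)]] by metis
    then show "\<exists>P h. cmp CTS h f' = indicator_arrow e D P \<and> (\<forall>v\<in>actions D. P v \<longleftrightarrow> v = u)"
      by (auto simp: P_def)
  qed
qed

lemma cofibrations_colimit:
  fixes D :: "'i \<Rightarrow> ('u, 'u, 'l) hdts"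
  assumes wo: "Well_order r" and I: "I \<subseteq> Field r" and diag: "diagram CTS r D d"
    and K: "\<And>i j. i \<in> I \<Longrightarrow> j \<in> I \<Longrightarrow> (i, j) \<in> r \<Longrightarrow> d i j \<in> cofibrations"
    and Y: "colimit_cocone CTS r I D d Y c" and i: "i \<in> I"
  shows "c i \<in> cofibrations"
proof -
  have wr: "wo_rel r" using wo by (simp add: wo_rel_def)
  have trans: "(a, b) \<in> r \<Longrightarrow> (b, c) \<in> r \<Longrightarrow> (a, c) \<in> r" for a b c
    using wo_rel.TRANS[OF wr] by (meson transD)
  have total: "(a, b) \<in> r \<or> (b, a) \<in> r" if "a \<in> I" "b \<in> I" for a b
    using wo_rel.TOTALS[OF wr] I that by blast
  have refl: "(a, a) \<in> r" if "a \<in> I" for a using total[OF that that] by blast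
  have d_hom: "d j k \<in> hom CTS (D j) (D k)" if "(j, k) \<in> r" for j k
    using diag that by (auto simp: diagram_def)
  have d_cmp: "ac (d k l) (ac (d j k) x) = ac (d j l) x"
    if "(j, k) \<in> r" "(k, l) \<in> r" "x \<in> actions (D j)" for j k l x
  proof -
    have "cmp CTS (d k l) (d j k) = d j l" using diag that unfolding diagram_def by blast
    from arg_cong[OF this, of "\<lambda>k. ac k x"] show ?thesis
      using d_hom[OF that(1)] that(3) by (simp add: hom_CTS compose_eq)
  qed
  have d_inj: "ac (d j k) x = ac (d j k) y \<Longrightarrow> x = y"
    if "j \<in> I" "k \<in> I" "(j, k) \<in> r" "x \<in> actions (D j)" "y \<in> actions (D j)" for j k x y
    using K[OF that(1-3)] that(4,5) cofibrations_iff[OF d_hom[OF that(3)]] by (auto dest: inj_onD)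
  have D: "D j \<in> Ob CTS" if "j \<in> I" for j using diag I that by (auto simp: diagram_def)
  have c_hom: "c i \<in> hom CTS (D i) Y" using Y i by (auto simp: colimit_cocone_def cocone_def)
  show ?thesis
  proof (rule cofibrationI[OF c_hom])
    fix u assume u: "u \<in> actions (D i)"
    \<comment> \<open>Stage \<open>k\<close> marks the actions that eventually coincide with
      \<open>u\<close>. Following the diagram preserves and reflects this property, and at stage
      \<open>i\<close> only \<open>u\<close> has it, because the arrows of the diagram are injective
      on actions.\<close>
    define P where "P k x \<longleftrightarrow> (\<exists>m\<in>I. (i, m) \<in> r \<and> (k, m) \<in> r \<and> ac (d k m) x = ac (d i m) u)" for k x
    have "cocone CTS r I D d (twofold e) (\<lambda>k. indicator_arrow e (D k) (P k))"
      unfolding cocone_def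
    proof (intro conjI ballI impI)
      show "indicator_arrow e (D k) (P k) \<in> hom CTS (D k) (twofold e)" if "k \<in> I" for k
        using indicator_arrow_hom[OF D[OF that]] .
      fix k l assume kl: "k \<in> I" "l \<in> I" "(k, l) \<in> r"
      show "cmp CTS (indicator_arrow e (D l) (P l)) (d k l) = indicator_arrow e (D k) (P k)"
      proof (rule indicator_arrow_cmp[OF d_hom[OF kl(3)]])
        fix x assume x: "x \<in> actions (D k)"
        show "P l (ac (d k l) x) = P k x"
        proof
          assume "P l (ac (d k l) x)"
          then obtain m where "m \<in> I" "(i, m) \<in> r" "(l, m) \<in> r"
            "ac (d l m) (ac (d k l) x) = ac (d i m) u" by (auto simp: P_def)
          then show "P k x" using d_cmp[OF kl(3) _ x] trans[OF kl(3)] by (auto simp: P_def)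
        next
          assume "P k x"
          then obtain m where m: "m \<in> I" "(i, m) \<in> r" "(k, m) \<in> r" "ac (d k m) x = ac (d i m) u"
            by (auto simp: P_def)
          \<comment> \<open>The larger of \<open>m\<close> and \<open>l\<close>: an equality reached
            at stage \<open>m\<close> persists at \<open>n\<close>, and \<open>n\<close> also lies
            after \<open>l\<close>.\<close>
          define n where "n = (if (l, m) \<in> r then m else l)"
          have n: "n \<in> I" "(m, n) \<in> r" "(l, n) \<in> r"
            using total m(1) kl(2) refl by (auto simp: n_def)
          have "ac (d l n) (ac (d k l) x) = ac (d m n) (ac (d k m) x)"
            using d_cmp[OF kl(3) n(3) x] d_cmp[OF m(3) n(2) x] by simp
          also have "\<dots> = ac (d i n) u" using d_cmp[OF m(2) n(2) u] m(4) by simp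
          finally show "P l (ac (d k l) x)" using n trans[OF m(2) n(2)] by (auto simp: P_def)
        qed
      qed
    qed (rule twofold_Ob)
    then obtain h where "\<forall>k\<in>I. cmp CTS h (c k) = indicator_arrow e (D k) (P k)"
      using Y unfolding colimit_cocone_def by blast
    moreover have "P i v \<longleftrightarrow> v = u" if "v \<in> actions (D i)" for v
      using d_inj[OF i _ _ that u] i refl by (auto simp: P_def)
    ultimately show "\<exists>P h. cmp CTS h (c i) = indicator_arrow e (D i) P \<and>
        (\<forall>v\<in>actions (D i). P v \<longleftrightarrow> v = u)" using i by blast
  qed
qed

end

lemma cofibrations_ident: "A \<in> Ob CTS \<Longrightarrow> ident CTS A \<in> cofibrations"
  using category_ident_hom[OF category_CTS] cofibrations_iff[of "ident CTS A" A A]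
  by (auto simp: inj_on_def)

lemma cofibrations_cmp:
  assumes g: "g \<in> hom CTS A B" "g \<in> cofibrations" and h: "h \<in> hom CTS B D" "h \<in> cofibrations"
  shows "cmp CTS h g \<in> cofibrations"
proof -
  have "inj_on (ac g) (actions A)" "inj_on (ac h) (actions B)"
    using assms cofibrations_iff by blast+
  moreover have "source g = A" using g(1) by (simp add: hom_CTS)
  ultimately have "inj_on (ac (cmp CTS h g)) (actions A)"
    using hom_CTS_mem(2)[OF g(1)] by (auto simp: inj_on_def compose_eq)
  then show ?thesis
    using cofibrations_iff[OF category_cmp_hom[OF category_CTS g(1) h(1)]] by simp
qed

section \<open>Fibrancy\<close>

lemma discrete_Ob:
  assumes "infinite (UNIV :: 'u set)" and "finite S"
  shows "discrete (S :: 'u set) \<in> Ob CTS"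
  using assms by (simp add: Ob_CTS cubical_discrete small_finite)

text \<open>Being a cofibration is a condition on actions only, so the collapse of two isolated
  states to one is a cofibration. When \<open>p\<close> identifies \<open>a\<close> and
  \<open>b\<close>, a lift against this collapse makes them equal.\<close>

lemma rlp_cofibrations_inj_states:
  assumes inf: "infinite (UNIV :: 'u set)"
    and p: "p \<in> rlp CTS (cofibrations :: ('u, 'u, 'l) hdts_arrow set)"
  shows "inj_on (st p) (states (source p))"
proof (rule inj_onI)
  fix a b assume ab: "a \<in> states (source p)" "b \<in> states (source p)" "st p a = st p b"
  define A B where "A = source p" and "B = target p"
  have pAB: "p \<in> hom CTS A B" using p by (auto simp: rlp_def Ar_CTS A_def B_def)
  have AB: "A \<in> Ob CTS" "B \<in> Ob CTS" using pAB by (auto simp: hom_CTS)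
  define i :: "('u, 'u, 'l) hdts_arrow" where
    "i = \<lparr>source = discrete {a, b}, target = discrete {a}, st = (\<lambda>x\<in>{a, b}. a), ac = (\<lambda>_. undefined)\<rparr>"
  define u :: "('u, 'u, 'l) hdts_arrow" where
    "u = \<lparr>source = discrete {a, b}, target = A, st = (\<lambda>x\<in>{a, b}. x), ac = (\<lambda>_. undefined)\<rparr>"
  define v :: "('u, 'u, 'l) hdts_arrow" where
    "v = \<lparr>source = discrete {a}, target = B, st = (\<lambda>x\<in>{a}. st p a), ac = (\<lambda>_. undefined)\<rparr>"
  have i: "i \<in> hom CTS (discrete {a, b}) (discrete {a})"
    by (auto simp: hom_CTS discrete_Ob inf hdts_map_discrete i_def)
  have u: "u \<in> hom CTS (discrete {a, b}) A"
    using ab AB by (auto simp: hom_CTS discrete_Ob inf hdts_map_discrete u_def A_def)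
  have v: "v \<in> hom CTS (discrete {a}) B"
    using ab AB hom_CTS_mem(1)[OF pAB]
    by (auto simp: hom_CTS discrete_Ob inf hdts_map_discrete v_def A_def)
  have "i \<in> cofibrations" using cofibrations_iff[OF i] by simp
  then have "lifts CTS i p" using p by (simp add: rlp_def)
  moreover have "cmp CTS p u = cmp CTS v i"
    by (rule hom_CTS_eqI[OF category_cmp_hom[OF category_CTS u pAB]
          category_cmp_hom[OF category_CTS i v]])
      (use ab(3) in \<open>auto simp: compose_eq i_def u_def v_def\<close>)
  moreover have "source i = discrete {a, b}" "target i = discrete {a}" by (simp_all add: i_def)
  ultimately obtain h where "cmp CTS h i = u"
    using u v unfolding lifts_def by (fastforce simp: A_def B_def)
  then have "st h (st i a) = st u a" "st h (st i b) = st u b"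
    by (auto simp: i_def compose_def dest!: arg_cong[of _ _ st] fun_cong)
  then show "a = b" by (simp add: i_def u_def)
qed

text \<open>Every object is cofibrant: the arrow from the empty system is a cofibration. The section
  is a lift of the identity against it.\<close>

lemma rlp_cofibrations_section:
  assumes inf: "infinite (UNIV :: 'u set)"
    and p: "p \<in> rlp CTS (cofibrations :: ('u, 'u, 'l) hdts_arrow set)"
  obtains s where "s \<in> hom CTS (target p) (source p)" "cmp CTS p s = ident CTS (target p)"
proof -
  define A B where "A = source p" and "B = target p"
  have pAB: "p \<in> hom CTS A B" using p by (auto simp: rlp_def Ar_CTS A_def B_def)
  have AB: "A \<in> Ob CTS" "B \<in> Ob CTS" using pAB by (auto simp: hom_CTS)
  define k :: "('u, 'u, 'l) hdts \<Rightarrow> ('u, 'u, 'l) hdts_arrow" where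
    "k Z = \<lparr>source = discrete {}, target = Z, st = (\<lambda>_. undefined), ac = (\<lambda>_. undefined)\<rparr>" for Z
  have k: "k Z \<in> hom CTS (discrete {}) Z" if "Z \<in> Ob CTS" for Z
    using that by (auto simp: hom_CTS discrete_Ob inf hdts_map_discrete k_def)
  have id: "ident CTS B \<in> hom CTS B B" using category_ident_hom[OF category_CTS AB(2)] .
  have "k B \<in> cofibrations" using cofibrations_iff[OF k[OF AB(2)]] by simp
  then have "lifts CTS (k B) p" using p by (simp add: rlp_def)
  moreover have "cmp CTS p (k A) = cmp CTS (ident CTS B) (k B)"
    by (rule hom_CTS_eqI[OF category_cmp_hom[OF category_CTS k[OF AB(1)] pAB]
          category_cmp_hom[OF category_CTS k[OF AB(2)] id]]) auto
  moreover have "source (k B) = discrete {}" "target (k B) = B" by (simp_all add: k_def)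
  ultimately obtain s where "s \<in> hom CTS B A" "cmp CTS p s = ident CTS B"
    using k[OF AB(1)] id unfolding lifts_def by (fastforce simp: A_def B_def)
  then show thesis using that by (simp add: A_def B_def)
qed

text \<open>Each action of \<open>A\<close> occurs in a 1-transition. The images of that transition
  under \<open>f\<close> and \<open>g\<close> have the same endpoints and the same label, so CSA1
  identifies their actions.\<close>

lemma CSA1_hom_eqI:
  assumes X: "CSA1 X" and f: "f \<in> hom CTS A X" and g: "g \<in> hom CTS A X"
    and st: "\<And>x. x \<in> states A \<Longrightarrow> st f x = st g x"
  shows "f = g"
proof (rule hom_CTS_eqI[OF f g st])
  fix u assume u: "u \<in> actions A"
  have A: "cubical A" using f by (simp add: hom_CTS Ob_CTS)
  obtain \<alpha> \<beta> where t: "(\<alpha>, [u], \<beta>) \<in> transitions A" using cubical_action_transition[OF A u] by blast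
  have "\<alpha> \<in> states A" "\<beta> \<in> states A" using whdts_transitionD[OF _ t] A by (auto simp: cubical_def)
  then have "(st f \<alpha>, [ac f u], st f \<beta>) \<in> transitions X" "(st f \<alpha>, [ac g u], st f \<beta>) \<in> transitions X"
    using hom_CTS_mem(4)[OF f t] hom_CTS_mem(4)[OF g t] st by auto
  moreover have "label X (ac f u) = label X (ac g u)"
    using hom_CTS_mem(3)[OF f u] hom_CTS_mem(3)[OF g u] by simp
  ultimately show "ac f u = ac g u" using X unfolding CSA1_def by blast
qed

lemma rlp_cofibrations_local:
  fixes X :: "('u, 'u, 'l) hdts"
  assumes inf: "infinite (UNIV :: 'u set)" and X: "CSA1 X" and p: "p \<in> rlp CTS cofibrations"
  shows "p \<in> local_equivalences CTS X"
proof -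
  define A B where "A = source p" and "B = target p"
  have pAB: "p \<in> hom CTS A B" using p by (auto simp: rlp_def Ar_CTS A_def B_def)
  obtain s where s: "s \<in> hom CTS B A" "cmp CTS p s = ident CTS B"
    using rlp_cofibrations_section[OF inf p] by (auto simp: A_def B_def)
  have src: "source s = B" "source p = A" using s pAB by (simp_all add: hom_CTS)
  have ps: "st p (st s y) = y" if "y \<in> states B" for y
    using arg_cong[OF s(2), of "\<lambda>k. st k y"] that src by (simp add: compose_eq)
  \<comment> \<open>On states, following \<open>p\<close> by \<open>s\<close> and again by
    \<open>p\<close> gives \<open>p\<close>, and \<open>p\<close> is injective there.\<close>
  have sp: "st s (st p x) = x" if x: "x \<in> states A" for x
  proof (rule inj_onD[OF rlp_cofibrations_inj_states[OF inf p]])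
    show "st p (st s (st p x)) = st p x" using ps hom_CTS_mem(1)[OF pAB x] by blast
    show "st s (st p x) \<in> states (source p)" "x \<in> states (source p)"
      using hom_CTS_mem(1)[OF s(1)] hom_CTS_mem(1)[OF pAB x] x by (auto simp: A_def)
  qed
  show ?thesis
    unfolding local_equivalences_iff[OF category_CTS pAB]
  proof
    fix g assume g: "g \<in> hom CTS A X"
    have gs: "cmp CTS g s \<in> hom CTS B X" using category_cmp_hom[OF category_CTS s(1) g] .
    show "\<exists>!h. h \<in> hom CTS B X \<and> cmp CTS h p = g"
    proof (rule ex1I)
      \<comment> \<open>Going through \<open>p\<close> and \<open>s\<close> fixes states but may
        move an action within its fibre under \<open>p\<close>. CSA1 for \<open>X\<close> makes this
        move invisible after \<open>g\<close>.\<close>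
      have "cmp CTS (cmp CTS g s) p = g"
        by (rule CSA1_hom_eqI[OF X category_cmp_hom[OF category_CTS pAB gs] g])
          (use sp src hom_CTS_mem(1)[OF pAB] in \<open>auto simp: compose_eq\<close>)
      with gs show "cmp CTS g s \<in> hom CTS B X \<and> cmp CTS (cmp CTS g s) p = g" by blast
    next
      fix h assume h: "h \<in> hom CTS B X \<and> cmp CTS h p = g"
      then have "cmp CTS g s = cmp CTS h (cmp CTS p s)"
        using category_assoc[OF category_CTS s(1) pAB] by metis
      with s(2) h show "h = cmp CTS g s" using category_ident(1)[OF category_CTS] by metis
    qed
  qed
qed

text \<open>Stability is checked separately for cofibrations and for local equivalences, since a
  pushout or transfinite composite of arrows in the intersection is one in each class. The
  cardinality assumptions yield the encoding \<open>e\<close> behind the test system.\<close>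

lemma localizer_local_equivalences:
  fixes X :: "('u, 'u, 'l) hdts"
  assumes inf: "infinite (UNIV :: 'u set)" and l: "(UNIV :: 'l set) \<prec> (UNIV :: 'u set)"
    and X: "CSA1 X"
  shows "localizer CTS (small_ordinals :: 'u rel set) cofibrations (local_equivalences CTS X)"
proof -
  have lb: "(UNIV :: ('l \<times> bool) set) \<prec> (UNIV :: 'u set)" using times_bool_lesspoll[OF inf l] .
  then obtain e :: "'l \<times> bool \<Rightarrow> 'u" where e: "inj e"
    using lesspoll_imp_lepoll unfolding lepoll_def by blast
  have se: "small (range e)" using small_range[OF lb] .
  have "f \<in> cofibrations" "f \<in> local_equivalences CTS X"
    if r: "r \<in> small_ordinals"
      and f: "transfinite_composition CTS r (cofibrations \<inter> local_equivalences CTS X) f"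
    for r :: "'u rel" and f
  proof -
    have wo: "Well_order r" using r by (simp add: small_ordinals_def)
    show "f \<in> cofibrations"
    proof (rule transfinite_compositionI[OF transfinite_composition_mono[OF f Int_lower1] wo
          cofibrations_ident])
      fix A B D g h
      assume "g \<in> hom CTS A B" "h \<in> hom CTS B D" "g \<in> cofibrations" "h \<in> cofibrations"
      then show "cmp CTS h g \<in> cofibrations" by (intro cofibrations_cmp)
    next
      fix I and D :: "'u \<Rightarrow> ('u, 'u, 'l) hdts" and d Y c i
      assume "I \<subseteq> Field r" "diagram CTS r D d"
        "\<And>i j. i \<in> I \<Longrightarrow> j \<in> I \<Longrightarrow> (i, j) \<in> r \<Longrightarrow> d i j \<in> cofibrations"
        "colimit_cocone CTS r I D d Y c" "i \<in> I"
      from cofibrations_colimit[OF inf e se wo this] show "c i \<in> cofibrations" .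
    qed
    show "f \<in> local_equivalences CTS X"
    proof (rule transfinite_compositionI[OF transfinite_composition_mono[OF f Int_lower2] wo
          local_equivalences_ident[OF category_CTS]])
      fix A B D g h
      assume "g \<in> hom CTS A B" "h \<in> hom CTS B D" "g \<in> local_equivalences CTS X" "h \<in> local_equivalences CTS X"
      then show "cmp CTS h g \<in> local_equivalences CTS X" by (intro local_equivalences_cmp[OF category_CTS])
    next
      fix I and D :: "'u \<Rightarrow> ('u, 'u, 'l) hdts" and d Y c i
      assume "I \<subseteq> Field r" "diagram CTS r D d"
        "\<And>i j. i \<in> I \<Longrightarrow> j \<in> I \<Longrightarrow> (i, j) \<in> r \<Longrightarrow> d i j \<in> local_equivalences CTS X"
        "colimit_cocone CTS r I D d Y c" "i \<in> I"
      from local_equivalences_colimit[OF category_CTS wo this] show "c i \<in> local_equivalences CTS X" .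
    qed
  qed
  then have "closed_under_transfinite_composition CTS (small_ordinals :: 'u rel set)
      (cofibrations \<inter> local_equivalences CTS X)"
    unfolding closed_under_transfinite_composition_def by blast
  moreover have "closed_under_pushout CTS (cofibrations \<inter> local_equivalences CTS X)"
    unfolding closed_under_pushout_def
    using cofibrations_pushout[OF inf e se] local_equivalences_pushout[OF category_CTS] by blast
  moreover have "rlp CTS cofibrations \<subseteq> local_equivalences CTS X"
    using rlp_cofibrations_local[OF inf X] by blast
  moreover have "local_equivalences CTS X \<subseteq> Ar CTS" by (auto simp: local_equivalences_def)
  ultimately show ?thesis
    using local_equivalences_two_out_of_three[OF category_CTS] by (simp add: localizer_def)
qed

text \<open>With a single action for each label the value of a map on an action is forced by its
  label, and with a single state there is no choice on states.\<close>

lemma terminal_object_CTS: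
  fixes e :: "'l \<Rightarrow> 'u"
  assumes inf: "infinite (UNIV :: 'u set)" and e: "inj e" and small_e: "small (range e)"
  shows "terminal_object CTS (chaotic undefined (range e) (inv e))"
    (is "terminal_object CTS ?T")
  unfolding terminal_object_def
proof (intro conjI ballI)
  show T: "?T \<in> Ob CTS" using inf small_e by (rule chaotic_Ob)
  fix A :: "('u, 'u, 'l) hdts" assume A: "A \<in> Ob CTS"
  then have wA: "whdts A" by (simp add: Ob_CTS cubical_def)
  show "\<exists>!f. f \<in> hom CTS A ?T"
  proof (rule ex_ex1I)
    have "\<lparr>source = A, target = ?T, st = (\<lambda>x\<in>states A. undefined),
        ac = (\<lambda>u\<in>actions A. e (label A u))\<rparr> \<in> hom CTS A ?T"
      using A T e by (auto simp: hom_CTS hdts_map_chaotic[OF wA])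
    then show "\<exists>f. f \<in> hom CTS A ?T" by blast
  next
    fix f g assume f: "f \<in> hom CTS A ?T" and g: "g \<in> hom CTS A ?T"
    have *: "ac k u = e (label A u)" if "k \<in> hom CTS A ?T" "u \<in> actions A" for k u
    proof -
      have "ac k u \<in> range e" "inv e (ac k u) = label A u"
        using that by (auto simp: hom_CTS hdts_map_chaotic[OF wA])
      then show ?thesis by (metis f_inv_into_f)
    qed
    show "f = g"
      by (rule hom_CTS_eqI[OF f g])
        (use f g *[OF f] *[OF g] in \<open>auto simp: hom_CTS hdts_map_chaotic[OF wA]\<close>)
  qed
qed

theorem proposition7p8:
  fixes X :: "('u, 'u, 'l) hdts"
  assumes "infinite (UNIV :: 'u set)"
    and "(UNIV :: 'l set) \<prec> (UNIV :: 'u set)"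
    and "X \<in> Ob CTS"
    and "CSA1 X"
  shows "fibrant CTS left_determined_CTS X"
proof -
  obtain e :: "'l \<Rightarrow> 'u" where e: "inj e"
    using lesspoll_imp_lepoll[OF assms(2)] unfolding lepoll_def by blast
  define T :: "('u, 'u, 'l) hdts" where "T = chaotic undefined (range e) (inv e)"
  have T: "terminal_object CTS T"
    unfolding T_def using terminal_object_CTS[OF assms(1) e small_range[OF assms(2)]] .
  then obtain f where f: "f \<in> hom CTS X T" using assms(3) unfolding terminal_object_def by blast
  \<comment> \<open>Extending \<open>u\<close> along \<open>i\<close> settles the upper triangle;
    the lower one commutes because arrows into \<open>T\<close> are unique.\<close>
  have "lifts CTS i f"
    if i: "i \<in> cofibrations" "i \<in> smallest_localizer CTS (small_ordinals :: 'u rel set) cofibrations" for i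
    unfolding lifts_def
  proof (intro allI impI)
    have iAB: "i \<in> hom CTS (source i) (target i)"
      using i(1) by (simp add: cofibrations_def Ar_CTS)
    have "i \<in> local_equivalences CTS X"
      using smallest_localizer_least[OF localizer_local_equivalences[OF assms(1,2,4)]] i(2) by blast
    note ext = this[unfolded local_equivalences_iff[OF category_CTS iAB], rule_format]
    fix u v assume u: "u \<in> hom CTS (src CTS i) (src CTS f)" and v: "v \<in> hom CTS (tgt CTS i) (tgt CTS f)"
    have s: "source f = X" "target f = T" using f by (auto simp: hom_CTS)
    have "u \<in> hom CTS (source i) X" using u s by simp
    from ext[OF this] obtain h where h: "h \<in> hom CTS (target i) X" "cmp CTS h i = u" by blast
    have "cmp CTS f h \<in> hom CTS (target i) T" using category_cmp_hom[OF category_CTS h(1) f] .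
    moreover have "v \<in> hom CTS (target i) T" "target i \<in> Ob CTS"
      using v s by (auto simp: hom_CTS)
    ultimately have "cmp CTS f h = v" using T unfolding terminal_object_def by blast
    with h s show "\<exists>h\<in>hom CTS (tgt CTS i) (src CTS f). cmp CTS h i = u \<and> cmp CTS f h = v" by auto
  qed
  moreover have "f \<in> Ar CTS" using f by (simp add: hom_def)
  ultimately have "f \<in> fibs left_determined_CTS"
    by (simp add: left_determined_CTS_def left_determined_def rlp_def)
  with assms(3) f T show ?thesis unfolding fibrant_def by blast
qed

end
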